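(* Let $A$ and $A'$ be abelian groups, let $w$ be an $A$-valued weight system (a linear map from $\mathcal A$ to $A$), and let $w'$ be an $A'$-valued framed weight system (a linear map from $\mathcal M$ to $A'$). Then the composition map $$(w\otimes w')\circ\delta_{\mathcal M}\colon\mathcal M\to A\otimes A'$$ is an $A\otimes A'$-valued framed weight system.
   Context: $\mathbb K$ is a field of characteristic $0$. Chord diagrams. For $n\ge 0$, an order $n$ chord diagram is a collection of $n$ chords, i.e. $n$ pairs of points on an oriented circle (all $2n$ points pairwise distinct), considered up to orientation preserving diffeomorphisms of the circle. An order $n$ framed chord diagram is a chord diagram together with a framing, i.e. a map from the set of chords to $\mathbb Z/2\mathbb Z$; chords of framing $0$ are called oriented, chords of framing $1$ are called disorienting. A framed chord diagram is black if all its chords are oriented. Ordinary chord diagrams are identified with black framed ones. Framed 4T-relations. Take any collection of framed chords on the oriented circle, containing a distinguished chord $v$ with endpoints $p,q$, and a further point $r$ on the circle distinct from all endpoints. Let $p^-,p^+$ (resp. $q^-,q^+$) be points immediately before and immediately after $p$ (resp. $q$) with respect to the orientation, with no other chord endpoint and not $r$ in between. For $x\in\{p^\pm,q^\pm\}$ and $\varphi\in\mathbb Z/2\mathbb Z$ let $D^{\varphi}(x)$ be the framed chord diagram obtained by adding one more chord $u$ (the jumping chord) with endpoints $r$ and $x$ and framing $\varphi$. The relations are, for each $\varphi$: if $v$ is oriented, $D^{\varphi}(p^-)-D^{\varphi}(p^+)=D^{\varphi}(q^+)-D^{\varphi}(q^-)$; if $v$ is disorienting, $D^{\varphi}(p^-)-D^{\varphi}(p^+)=D^{\varphi+1}(q^-)-D^{\varphi+1}(q^+)$.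 $\mathcal M$ is the $\mathbb K$-vector space spanned by all framed chord diagrams modulo all framed 4T-relations. $\mathcal A$ is the $\mathbb K$-vector space spanned by ordinary chord diagrams modulo the ordinary 4T-relations, i.e. the relations $D^{0}(p^-)-D^{0}(p^+)=D^{0}(q^+)-D^{0}(q^-)$ for collections of chords all of which (including $v$) are oriented. $\Delta_{\mathcal M}\colon\mathcal M\to\mathcal M\otimes\mathcal M$ is the (well-defined) linear map $d\mapsto\sum d_I\otimes d_J$, the sum over all ways to decompose the set of chords of $d$ into two disjoint subsets $I$ and $J$, where $d_I$ is the subdiagram formed by the chords in $I$. $Pr_{\mathcal M}\colon\mathcal M\to\mathcal A$ is the (well-defined) linear map with $Pr_{\mathcal M}(d)=d$ if $d$ is black and $0$ otherwise. $\delta_{\mathcal M}=(Pr_{\mathcal M}\otimes\mathrm{id})\circ\Delta_{\mathcal M}\colon\mathcal M\to\mathcal A\otimes\mathcal M$. For an abelian group $A$, an $A$-valued weight system is a linear map from $\mathcal A$ to $A$, and an $A$-valued framed weight system is a linear map from $\mathcal M$ to $A$. *)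

theory Defs
  imports "HOL-Analysis.Analysis" "HOL-Algebra.Module" "HOL-Algebra.AbelCoset"
    "HOL-Library.Z2"
begin

section \<open>Linear algebra over a field\<close>

text \<open>
  Vector spaces are modules (in the sense of HOL-Algebra) over a field. The record fields
  \<open>mult\<close> and \<open>one\<close> of the carrier record of a module play no role.
\<close>

definition characteristic_zero :: "('k, 'r) ring_scheme \<Rightarrow> bool" where
  "characteristic_zero K \<longleftrightarrow>
     (\<forall>n::nat. n > 0 \<longrightarrow> [n] \<cdot>\<^bsub>K\<^esub> \<one>\<^bsub>K\<^esub> \<noteq> \<zero>\<^bsub>K\<^esub>)"

definition linear_maps ::
    "('k, 'r) ring_scheme \<Rightarrow> ('k, 'v, 's) module_scheme \<Rightarrow> ('k, 'w, 't) module_scheme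
      \<Rightarrow> ('v \<Rightarrow> 'w) set" where
  "linear_maps K V W =
     {f \<in> carrier V \<rightarrow> carrier W.
        (\<forall>x\<in>carrier V. \<forall>y\<in>carrier V. f (x \<oplus>\<^bsub>V\<^esub> y) = f x \<oplus>\<^bsub>W\<^esub> f y) \<and>
        (\<forall>c\<in>carrier K. \<forall>x\<in>carrier V. f (c \<odot>\<^bsub>V\<^esub> x) = c \<odot>\<^bsub>W\<^esub> f x)}"

definition free_module :: "('k, 'r) ring_scheme \<Rightarrow> 'x set \<Rightarrow> ('k, 'x \<Rightarrow> 'k) module" where
  "free_module K X =
     \<lparr>carrier = {f. (\<forall>x\<in>X. f x \<in> carrier K) \<and> (\<forall>x. x \<notin> X \<longrightarrow> f x = \<zero>\<^bsub>K\<^esub>) \<and>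
                    finite {x. f x \<noteq> \<zero>\<^bsub>K\<^esub>}},
      mult = undefined, one = undefined,
      zero = (\<lambda>x. \<zero>\<^bsub>K\<^esub>),
      add = (\<lambda>f g x. f x \<oplus>\<^bsub>K\<^esub> g x),
      smult = (\<lambda>c f x. c \<otimes>\<^bsub>K\<^esub> f x)\<rparr>"

definition basis_vector :: "('k, 'r) ring_scheme \<Rightarrow> 'x \<Rightarrow> 'x \<Rightarrow> 'k" where
  "basis_vector K x = (\<lambda>y. if y = x then \<one>\<^bsub>K\<^esub> else \<zero>\<^bsub>K\<^esub>)"

definition linear_extension ::
    "('k, 'r) ring_scheme \<Rightarrow> ('k, 'w, 't) module_scheme \<Rightarrow> ('x \<Rightarrow> 'w) \<Rightarrow> ('x \<Rightarrow> 'k) \<Rightarrow> 'w" where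
  "linear_extension K W g f =
     (\<Oplus>\<^bsub>W\<^esub>x\<in>{x. f x \<noteq> \<zero>\<^bsub>K\<^esub>}. f x \<odot>\<^bsub>W\<^esub> g x)"

definition generated_submodule ::
    "('k, 'r) ring_scheme \<Rightarrow> ('k, 'v, 's) module_scheme \<Rightarrow> 'v set \<Rightarrow> 'v set" where
  "generated_submodule K V R = \<Inter>{H. submodule H K V \<and> R \<subseteq> H}"

definition quotient_module :: "('k, 'v, 's) module_scheme \<Rightarrow> 'v set \<Rightarrow> ('k, 'v set) module" where
  "quotient_module V H =
     \<lparr>carrier = a_rcosets\<^bsub>V\<^esub> H,
      mult = undefined, one = undefined,
      zero = H,
      add = (\<lambda>Y Z. Y <+>\<^bsub>V\<^esub> Z),
      smult = (\<lambda>c Y. \<Union>y\<in>Y. H +>\<^bsub>V\<^esub> (c \<odot>\<^bsub>V\<^esub> y))\<rparr>"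

text \<open>
  The value of a function at a class on which it is constant; this is how functions given on
  representatives are transported to quotients.
\<close>

definition induced :: "('x \<Rightarrow> 'y) \<Rightarrow> 'x set \<Rightarrow> 'y" where
  "induced f Y = the_elem (f ` Y)"

definition tensor_relations ::
    "('k, 'r) ring_scheme \<Rightarrow> ('k, 'v, 's) module_scheme \<Rightarrow> ('k, 'w, 't) module_scheme
      \<Rightarrow> ('v \<times> 'w \<Rightarrow> 'k) set" where
  "tensor_relations K V W =
     (let F = free_module K (carrier V \<times> carrier W); e = basis_vector K in
       {e (x \<oplus>\<^bsub>V\<^esub> x', y) \<ominus>\<^bsub>F\<^esub> (e (x, y) \<oplus>\<^bsub>F\<^esub> e (x', y)) | x x' y.
          x \<in> carrier V \<and> x' \<in> carrier V \<and> y \<in> carrier W} \<union>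
       {e (x, y \<oplus>\<^bsub>W\<^esub> y') \<ominus>\<^bsub>F\<^esub> (e (x, y) \<oplus>\<^bsub>F\<^esub> e (x, y')) | x y y'.
          x \<in> carrier V \<and> y \<in> carrier W \<and> y' \<in> carrier W} \<union>
       {e (c \<odot>\<^bsub>V\<^esub> x, y) \<ominus>\<^bsub>F\<^esub> c \<odot>\<^bsub>F\<^esub> e (x, y) | c x y.
          c \<in> carrier K \<and> x \<in> carrier V \<and> y \<in> carrier W} \<union>
       {e (x, c \<odot>\<^bsub>W\<^esub> y) \<ominus>\<^bsub>F\<^esub> c \<odot>\<^bsub>F\<^esub> e (x, y) | c x y.
          c \<in> carrier K \<and> x \<in> carrier V \<and> y \<in> carrier W})"

definition tensor_kernel ::
    "('k, 'r) ring_scheme \<Rightarrow> ('k, 'v, 's) module_scheme \<Rightarrow> ('k, 'w, 't) module_scheme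
      \<Rightarrow> ('v \<times> 'w \<Rightarrow> 'k) set" where
  "tensor_kernel K V W =
     generated_submodule K (free_module K (carrier V \<times> carrier W)) (tensor_relations K V W)"

definition tensor_product ::
    "('k, 'r) ring_scheme \<Rightarrow> ('k, 'v, 's) module_scheme \<Rightarrow> ('k, 'w, 't) module_scheme
      \<Rightarrow> ('k, ('v \<times> 'w \<Rightarrow> 'k) set) module" where
  "tensor_product K V W =
     quotient_module (free_module K (carrier V \<times> carrier W)) (tensor_kernel K V W)"

definition pure_tensor ::
    "('k, 'r) ring_scheme \<Rightarrow> ('k, 'v, 's) module_scheme \<Rightarrow> ('k, 'w, 't) module_scheme
      \<Rightarrow> 'v \<Rightarrow> 'w \<Rightarrow> ('v \<times> 'w \<Rightarrow> 'k) set" where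
  "pure_tensor K V W x y =
     tensor_kernel K V W +>\<^bsub>free_module K (carrier V \<times> carrier W)\<^esub> basis_vector K (x, y)"

text \<open>The map \<open>f \<otimes> g\<close> with target the tensor product of \<open>V'\<close> and \<open>W'\<close>.\<close>

definition tensor_map ::
    "('k, 'r) ring_scheme \<Rightarrow> ('k, 'v2, 's) module_scheme \<Rightarrow> ('k, 'w2, 't) module_scheme
      \<Rightarrow> ('v \<Rightarrow> 'v2) \<Rightarrow> ('w \<Rightarrow> 'w2) \<Rightarrow> ('v \<times> 'w \<Rightarrow> 'k) set \<Rightarrow> ('v2 \<times> 'w2 \<Rightarrow> 'k) set" where
  "tensor_map K V' W' f g =
     induced (linear_extension K (tensor_product K V' W')
       (\<lambda>(x, y). pure_tensor K V' W' (f x) (g y)))"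


section \<open>Framed chord diagrams\<close>

text \<open>
  The oriented circle is the unit circle of the complex plane with its counterclockwise
  orientation. A framed chord is a two-element set of points of the circle together with its
  framing in \<open>bit\<close>, the field with two elements; disjointness of the chords makes the framing a
  function of the chord.
\<close>

type_synonym framed_chord = "complex set \<times> bit"
type_synonym framed_chord_diagram = "framed_chord set set"

definition chord_collection :: "framed_chord set \<Rightarrow> bool" where
  "chord_collection X \<longleftrightarrow>
     finite X \<and>
     (\<forall>(c, \<phi>)\<in>X. c \<subseteq> sphere 0 1 \<and> card c = 2) \<and>
     (\<forall>a\<in>X. \<forall>b\<in>X. a \<noteq> b \<longrightarrow> fst a \<inter> fst b = {})"

definition endpoints :: "framed_chord set \<Rightarrow> complex set" where
  "endpoints X = \<Union>(fst ` X)"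

definition all_oriented :: "framed_chord set \<Rightarrow> bool" where
  "all_oriented X \<longleftrightarrow> (\<forall>(c, \<phi>)\<in>X. \<phi> = 0)"

definition smooth_real :: "(real \<Rightarrow> real) \<Rightarrow> bool" where
  "smooth_real f \<longleftrightarrow> (\<forall>n t. (deriv ^^ n) f field_differentiable at t)"

text \<open>
  Orientation preserving diffeomorphisms of the circle are the maps that lift, along
  \<open>t \<mapsto> cis t\<close>, to a smooth \<open>f\<close> on the real line with positive derivative and
  \<open>f (t + 2\<pi>) = f t + 2\<pi>\<close>. Values off the circle are irrelevant.
\<close>

definition oriented_circle_diffeo :: "(complex \<Rightarrow> complex) \<Rightarrow> bool" where
  "oriented_circle_diffeo h \<longleftrightarrow>
     (\<exists>f. smooth_real f \<and> (\<forall>t. deriv f t > 0) \<and> (\<forall>t. f (t + 2 * pi) = f t + 2 * pi) \<and>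
          (\<forall>t. h (cis t) = cis (f t)))"

text \<open>
  A framed chord diagram is an orbit of chord collections, so that its elements are the
  collections that represent it.
\<close>

definition diagram :: "framed_chord set \<Rightarrow> framed_chord_diagram" where
  "diagram X = {map_prod (image h) id ` X | h. oriented_circle_diffeo h}"

definition framed_chord_diagrams :: "framed_chord_diagram set" where
  "framed_chord_diagrams = {diagram X | X. chord_collection X}"

definition black_chord_diagrams :: "framed_chord_diagram set" where
  "black_chord_diagrams = {diagram X | X. chord_collection X \<and> all_oriented X}"


section \<open>The 4T-relations\<close>

text \<open>The open arc run through counterclockwise from \<open>x\<close> to \<open>y\<close>, where \<open>x \<noteq> y\<close>.\<close>

definition open_arc :: "complex \<Rightarrow> complex \<Rightarrow> complex set" where
  "open_arc x y =
     {cis t | t a b. cis a = x \<and> cis b = y \<and> a < t \<and> t < b \<and> b < a + 2 * pi}"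

text \<open>
  \<open>P\<close> is the set of marked points on the circle (all chord endpoints and \<open>r\<close>) and \<open>p \<in> P\<close>; the
  condition \<open>x \<notin> P\<close> thus entails \<open>x \<noteq> p\<close>.
\<close>

definition immediately_before :: "complex set \<Rightarrow> complex \<Rightarrow> complex \<Rightarrow> bool" where
  "immediately_before P p x \<longleftrightarrow> x \<in> sphere 0 1 - P \<and> open_arc x p \<inter> P = {}"

definition immediately_after :: "complex set \<Rightarrow> complex \<Rightarrow> complex \<Rightarrow> bool" where
  "immediately_after P p x \<longleftrightarrow> x \<in> sphere 0 1 - P \<and> open_arc p x \<inter> P = {}"

text \<open>
  The data of a 4T-relation: a collection \<open>X\<close> containing the distinguished chord \<open>v\<close> with
  endpoints \<open>p\<close> and \<open>q\<close> and framing \<open>\<psi>\<close>, the fixed endpoint \<open>r\<close> of the jumping chord, and the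
  four positions of its other endpoint.
\<close>

definition four_term_data ::
    "framed_chord set \<Rightarrow> bit \<Rightarrow> complex \<Rightarrow> complex \<Rightarrow> complex
      \<Rightarrow> complex \<Rightarrow> complex \<Rightarrow> complex \<Rightarrow> complex \<Rightarrow> bool" where
  "four_term_data X \<psi> p q r pm pp qm qp \<longleftrightarrow>
     chord_collection X \<and> ({p, q}, \<psi>) \<in> X \<and> r \<in> sphere 0 1 - endpoints X \<and>
     (let P = insert r (endpoints X) in
        immediately_before P p pm \<and> immediately_after P p pp \<and>
        immediately_before P q qm \<and> immediately_after P q qp)"

definition with_jumping_chord ::
    "framed_chord set \<Rightarrow> complex \<Rightarrow> bit \<Rightarrow> complex \<Rightarrow> framed_chord_diagram" where
  "with_jumping_chord X r \<phi> x = diagram (insert ({r, x}, \<phi>) X)"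

definition framed_4T_relations ::
    "('k, 'r) ring_scheme \<Rightarrow> (framed_chord_diagram \<Rightarrow> 'k) set" where
  "framed_4T_relations K =
     (let F = free_module K framed_chord_diagrams;
          D = (\<lambda>X r \<phi> x. basis_vector K (with_jumping_chord X r \<phi> x)) in
       {(D X r \<phi> pm \<ominus>\<^bsub>F\<^esub> D X r \<phi> pp) \<ominus>\<^bsub>F\<^esub> (D X r \<phi> qp \<ominus>\<^bsub>F\<^esub> D X r \<phi> qm)
          | X p q r pm pp qm qp \<phi>. four_term_data X 0 p q r pm pp qm qp} \<union>
       {(D X r \<phi> pm \<ominus>\<^bsub>F\<^esub> D X r \<phi> pp) \<ominus>\<^bsub>F\<^esub> (D X r (\<phi> + 1) qm \<ominus>\<^bsub>F\<^esub> D X r (\<phi> + 1) qp)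
          | X p q r pm pp qm qp \<phi>. four_term_data X 1 p q r pm pp qm qp})"

definition ordinary_4T_relations ::
    "('k, 'r) ring_scheme \<Rightarrow> (framed_chord_diagram \<Rightarrow> 'k) set" where
  "ordinary_4T_relations K =
     (let F = free_module K black_chord_diagrams;
          D = (\<lambda>X r x. basis_vector K (with_jumping_chord X r 0 x)) in
       {(D X r pm \<ominus>\<^bsub>F\<^esub> D X r pp) \<ominus>\<^bsub>F\<^esub> (D X r qp \<ominus>\<^bsub>F\<^esub> D X r qm)
          | X p q r pm pp qm qp. all_oriented X \<and> four_term_data X 0 p q r pm pp qm qp})"


section \<open>The spaces of framed and of ordinary chord diagrams\<close>

definition framed_4T_span ::
    "('k, 'r) ring_scheme \<Rightarrow> (framed_chord_diagram \<Rightarrow> 'k) set" where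
  "framed_4T_span K =
     generated_submodule K (free_module K framed_chord_diagrams) (framed_4T_relations K)"

definition framed_space ::
    "('k, 'r) ring_scheme \<Rightarrow> ('k, (framed_chord_diagram \<Rightarrow> 'k) set) module" where
  "framed_space K = quotient_module (free_module K framed_chord_diagrams) (framed_4T_span K)"

definition framed_class ::
    "('k, 'r) ring_scheme \<Rightarrow> framed_chord_diagram \<Rightarrow> (framed_chord_diagram \<Rightarrow> 'k) set" where
  "framed_class K d =
     framed_4T_span K +>\<^bsub>free_module K framed_chord_diagrams\<^esub> basis_vector K d"

definition ordinary_4T_span ::
    "('k, 'r) ring_scheme \<Rightarrow> (framed_chord_diagram \<Rightarrow> 'k) set" where
  "ordinary_4T_span K =
     generated_submodule K (free_module K black_chord_diagrams) (ordinary_4T_relations K)"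

definition ordinary_space ::
    "('k, 'r) ring_scheme \<Rightarrow> ('k, (framed_chord_diagram \<Rightarrow> 'k) set) module" where
  "ordinary_space K = quotient_module (free_module K black_chord_diagrams) (ordinary_4T_span K)"

definition ordinary_class ::
    "('k, 'r) ring_scheme \<Rightarrow> framed_chord_diagram \<Rightarrow> (framed_chord_diagram \<Rightarrow> 'k) set" where
  "ordinary_class K d =
     ordinary_4T_span K +>\<^bsub>free_module K black_chord_diagrams\<^esub> basis_vector K d"


section \<open>Comultiplication, projection and coaction\<close>

definition comult ::
    "('k, 'r) ring_scheme \<Rightarrow> (framed_chord_diagram \<Rightarrow> 'k) set
      \<Rightarrow> ((framed_chord_diagram \<Rightarrow> 'k) set \<times> (framed_chord_diagram \<Rightarrow> 'k) set \<Rightarrow> 'k) set" where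
  "comult K =
     (let M = framed_space K; T = tensor_product K M M in
       induced (linear_extension K T
         (induced (\<lambda>X. \<Oplus>\<^bsub>T\<^esub>I\<in>Pow X.
            pure_tensor K M M (framed_class K (diagram I)) (framed_class K (diagram (X - I)))))))"

definition black_projection ::
    "('k, 'r) ring_scheme \<Rightarrow> (framed_chord_diagram \<Rightarrow> 'k) set
      \<Rightarrow> (framed_chord_diagram \<Rightarrow> 'k) set" where
  "black_projection K =
     induced (linear_extension K (ordinary_space K)
       (\<lambda>d. if d \<in> black_chord_diagrams then ordinary_class K d else \<zero>\<^bsub>ordinary_space K\<^esub>))"

definition coaction ::
    "('k, 'r) ring_scheme \<Rightarrow> (framed_chord_diagram \<Rightarrow> 'k) set
      \<Rightarrow> ((framed_chord_diagram \<Rightarrow> 'k) set \<times> (framed_chord_diagram \<Rightarrow> 'k) set \<Rightarrow> 'k) set" where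
  "coaction K =
     tensor_map K (ordinary_space K) (framed_space K) (black_projection K) id \<circ> comult K"


section \<open>Weight systems\<close>

text \<open>
  Linearity of a map from a vector space over \<open>K\<close> to an abelian group \<open>A\<close> refers to an action of
  \<open>K\<close> on \<open>A\<close>, so the abelian group \<open>A\<close> comes as a module over \<open>K\<close>.
\<close>

definition weight_system ::
    "('k, 'r) ring_scheme \<Rightarrow> ('k, 'a, 's) module_scheme
      \<Rightarrow> ((framed_chord_diagram \<Rightarrow> 'k) set \<Rightarrow> 'a) \<Rightarrow> bool" where
  "weight_system K A w \<longleftrightarrow> module K A \<and> w \<in> linear_maps K (ordinary_space K) A"

definition framed_weight_system ::
    "('k, 'r) ring_scheme \<Rightarrow> ('k, 'a, 's) module_scheme
      \<Rightarrow> ((framed_chord_diagram \<Rightarrow> 'k) set \<Rightarrow> 'a) \<Rightarrow> bool" where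
  "framed_weight_system K A w \<longleftrightarrow> module K A \<and> w \<in> linear_maps K (framed_space K) A"

end

theory Submission
  imports Defs
begin

text \<open>
  The map is a composite of maps induced on quotients and tensor products, so everything reduces
  to \<open>\<Delta>\<close> and \<open>Pr\<close> respecting the 4T-relations. For \<open>\<Delta>\<close>, split the chords other than the
  jumping chord \<open>u\<close> into \<open>I\<close> and \<open>J\<close> and let \<open>u\<close> join either part. If that part contains the
  distinguished chord \<open>v\<close>, the four terms form a 4T-relation of the part. If it does not, then
  nothing prevents the end of \<open>u\<close> from sliding past the ends of \<open>v\<close>, and the terms cancel in
  pairs. For \<open>Pr\<close>, a relation either consists of black diagrams and is an ordinary 4T-relation,
  or has no black term.
\<close>

section \<open>Free modules, quotients and induced linear maps\<close>

text \<open>The weight of the proof is well-definedness: \<open>induced\<close> has a meaningful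
  value only at a class on which the underlying function is constant. This has to be secured at
  three levels: orbits of chord collections, quotients by 4T-relations, and tensor products. The
  obstacle is the word "slide". Diagrams are orbits under smooth diffeomorphisms, not combinatorial
  words, so equality of two diagrams requires an actual diffeomorphism that carries one position of
  the moving end to the other and fixes \<open>r\<close> and all remaining ends. It is obtained from
  a lift to the real line, whence the calculus with \<open>deriv\<close>. Both kinds of relations
  restrict to parts in the same way. The shift of framing depends on \<open>v\<close> alone, so a
  part containing \<open>v\<close> keeps a relation of the same kind. In a part without
  \<open>v\<close>, the two terms at \<open>p\<close> carry the same framing, and so do the two at
  \<open>q\<close>, so each pair cancels by itself.\<close>

lemma (in module) submodule_imp_abelian_subgroup:
  assumes "submodule H R M" shows "abelian_subgroup H M"
  using assms M.abelian_group_axioms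
  by (intro abelian_subgroupI3 additive_subgroup.intro) (auto dest: submodule.axioms)

text \<open>Carries the group structure of the additive factor group over to
  \<open>quotient_module\<close>, a different record with the same carrier and operations.\<close>

lemma comm_group_cong:
  assumes "comm_group G" "carrier G' = carrier G" "mult G' = mult G" "one G' = one G"
  shows "comm_group G'"
proof -
  interpret G: comm_group G by fact
  show ?thesis
    by (rule comm_groupI) (auto simp: assms(2-) G.m_assoc intro: G.l_inv_ex G.m_comm)
qed

lemma linear_mapsI:
  assumes "\<And>x. x \<in> carrier V \<Longrightarrow> f x \<in> carrier W"
    and "\<And>x y. x \<in> carrier V \<Longrightarrow> y \<in> carrier V \<Longrightarrow> f (x \<oplus>\<^bsub>V\<^esub> y) = f x \<oplus>\<^bsub>W\<^esub> f y"
    and "\<And>c x. c \<in> carrier K \<Longrightarrow> x \<in> carrier V \<Longrightarrow> f (c \<odot>\<^bsub>V\<^esub> x) = c \<odot>\<^bsub>W\<^esub> f x"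
  shows "f \<in> linear_maps K V W"
  using assms by (auto simp: linear_maps_def)

lemma linear_mapsD:
  assumes "f \<in> linear_maps K V W"
  shows "x \<in> carrier V \<Longrightarrow> f x \<in> carrier W"
    and "x \<in> carrier V \<Longrightarrow> y \<in> carrier V \<Longrightarrow> f (x \<oplus>\<^bsub>V\<^esub> y) = f x \<oplus>\<^bsub>W\<^esub> f y"
    and "c \<in> carrier K \<Longrightarrow> x \<in> carrier V \<Longrightarrow> f (c \<odot>\<^bsub>V\<^esub> x) = c \<odot>\<^bsub>W\<^esub> f x"
  using assms by (auto simp: linear_maps_def)

lemma linear_maps_comp:
  assumes "f \<in> linear_maps K U V" "g \<in> linear_maps K V W"
  shows "g \<circ> f \<in> linear_maps K U W"
  using assms by (auto simp: linear_maps_def Pi_def)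

lemma linear_maps_id: "id \<in> linear_maps K V V"
  by (auto simp: linear_maps_def)

lemma
  assumes "module K V" "module K W" "f \<in> linear_maps K V W"
  shows linear_maps_zero: "f \<zero>\<^bsub>V\<^esub> = \<zero>\<^bsub>W\<^esub>"
    and linear_maps_a_inv: "x \<in> carrier V \<Longrightarrow> f (\<ominus>\<^bsub>V\<^esub> x) = \<ominus>\<^bsub>W\<^esub> f x"
    and linear_maps_minus:
      "x \<in> carrier V \<Longrightarrow> y \<in> carrier V \<Longrightarrow> f (x \<ominus>\<^bsub>V\<^esub> y) = f x \<ominus>\<^bsub>W\<^esub> f y"
proof -
  interpret V: module K V by fact
  interpret W: module K W by fact
  interpret abelian_group_hom V W f
    using linear_mapsD[OF assms(3)]
    by (intro abelian_group_homI V.abelian_group_axioms W.abelian_group_axioms)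
       (auto simp: Group.group_hom_def group_hom_axioms_def hom_def)
  show "f \<zero>\<^bsub>V\<^esub> = \<zero>\<^bsub>W\<^esub>" by simp
  show inv: "f (\<ominus>\<^bsub>V\<^esub> x) = \<ominus>\<^bsub>W\<^esub> f x" if "x \<in> carrier V" for x using that by simp
  show "f (x \<ominus>\<^bsub>V\<^esub> y) = f x \<ominus>\<^bsub>W\<^esub> f y" if "x \<in> carrier V" "y \<in> carrier V"
    using that by (simp add: a_minus_def)
qed

lemma submodule_kernel:
  assumes "module K V" "module K W" "f \<in> linear_maps K V W"
  shows "submodule {x \<in> carrier V. f x = \<zero>\<^bsub>W\<^esub>} K V"
proof -
  interpret V: module K V by fact
  interpret W: module K W by fact
  show ?thesis
    by (rule V.submoduleI)
      (auto simp: linear_mapsD[OF assms(3)] linear_maps_zero[OF assms] linear_maps_a_inv[OF assms])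
qed

lemma (in module) generated_submodule_is_submodule:
  assumes "S \<subseteq> carrier M"
  shows "submodule (generated_submodule R M S) R M"
proof (rule submoduleI)
  show "generated_submodule R M S \<subseteq> carrier M"
    using carrier_is_submodule assms by (auto simp: generated_submodule_def)
qed (auto simp: generated_submodule_def submoduleE submodule.smult_closed
      intro: subgroup.one_closed[OF submodule.axioms(1), simplified])

lemma generated_submodule_incl: "S \<subseteq> generated_submodule K V S"
  by (auto simp: generated_submodule_def)

text \<open>The kernel of \<open>f\<close> is a submodule containing \<open>S\<close>, hence one of
  those intersected in \<open>generated_submodule\<close>.\<close>

lemma linear_maps_generated_submodule:
  assumes "module K V" "module K W" "f \<in> linear_maps K V W" "S \<subseteq> carrier V"
    and "\<And>x. x \<in> S \<Longrightarrow> f x = \<zero>\<^bsub>W\<^esub>" and "x \<in> generated_submodule K V S"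
  shows "f x = \<zero>\<^bsub>W\<^esub>"
  using submodule_kernel[OF assms(1-3)] assms(4-) by (auto simp: generated_submodule_def)

section \<open>Quotient modules and maps induced on them\<close>

context module
begin

lemma quotient_coset_eq_iff:
  assumes "submodule H R M" "x \<in> carrier M" "y \<in> carrier M"
  shows "H +>\<^bsub>M\<^esub> x = H +>\<^bsub>M\<^esub> y \<longleftrightarrow> x \<ominus>\<^bsub>M\<^esub> y \<in> H"
proof -
  interpret H: abelian_subgroup H M by (rule submodule_imp_abelian_subgroup) fact
  have "x \<in> H +>\<^bsub>M\<^esub> y \<longleftrightarrow> x \<ominus>\<^bsub>M\<^esub> y \<in> H"
    using H.a_rcos_module[OF assms(3,2)] by (simp add: a_minus_def)
  thus ?thesis
    using H.a_rcos_self[OF assms(2)] H.a_repr_independence'[OF _ assms(3)] by metis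
qed

lemma quotient_add:
  assumes "submodule H R M" "x \<in> carrier M" "y \<in> carrier M"
  shows "(H +>\<^bsub>M\<^esub> x) \<oplus>\<^bsub>quotient_module M H\<^esub> (H +>\<^bsub>M\<^esub> y) = H +>\<^bsub>M\<^esub> (x \<oplus>\<^bsub>M\<^esub> y)"
proof -
  interpret H: abelian_subgroup H M by (rule submodule_imp_abelian_subgroup) fact
  show ?thesis using assms by (simp add: quotient_module_def H.a_rcos_sum)
qed

text \<open>The defining union runs over all representatives \<open>y\<close> of the coset. It
  collapses because \<open>c\<close> times \<open>y - x\<close> stays in \<open>H\<close>, so every
  \<open>y\<close> contributes the same coset.\<close>

lemma quotient_smult:
  assumes "submodule H R M" "c \<in> carrier R" "x \<in> carrier M"
  shows "c \<odot>\<^bsub>quotient_module M H\<^esub> (H +>\<^bsub>M\<^esub> x) = H +>\<^bsub>M\<^esub> (c \<odot>\<^bsub>M\<^esub> x)"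
proof -
  interpret H: abelian_subgroup H M by (rule submodule_imp_abelian_subgroup) fact
  have "H +>\<^bsub>M\<^esub> (c \<odot>\<^bsub>M\<^esub> y) = H +>\<^bsub>M\<^esub> (c \<odot>\<^bsub>M\<^esub> x)" if y: "y \<in> H +>\<^bsub>M\<^esub> x" for y
  proof -
    have yc: "y \<in> carrier M" using y assms(3) H.a_elemrcos_carrier by blast
    have "y \<ominus>\<^bsub>M\<^esub> x \<in> H" using H.a_rcos_module[OF assms(3) yc] y by (simp add: a_minus_def)
    hence "c \<odot>\<^bsub>M\<^esub> (y \<ominus>\<^bsub>M\<^esub> x) \<in> H" using assms submoduleE(4) by blast
    moreover have "c \<odot>\<^bsub>M\<^esub> (y \<ominus>\<^bsub>M\<^esub> x) = c \<odot>\<^bsub>M\<^esub> y \<ominus>\<^bsub>M\<^esub> c \<odot>\<^bsub>M\<^esub> x"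
      using yc assms by (simp add: a_minus_def smult_r_distr smult_r_minus)
    ultimately show ?thesis using assms yc by (simp add: quotient_coset_eq_iff)
  qed
  moreover have "H +>\<^bsub>M\<^esub> x \<noteq> {}" using H.a_rcos_self[OF assms(3)] by blast
  ultimately have "(\<Union>y\<in>H +>\<^bsub>M\<^esub> x. H +>\<^bsub>M\<^esub> (c \<odot>\<^bsub>M\<^esub> y)) = H +>\<^bsub>M\<^esub> (c \<odot>\<^bsub>M\<^esub> x)"
    by (intro SUP_eq_const) blast+
  thus ?thesis by (simp add: quotient_module_def)
qed

lemma quotient_carrier: "carrier (quotient_module M H) = (\<lambda>x. H +>\<^bsub>M\<^esub> x) ` carrier M"
  by (auto simp: quotient_module_def A_RCOSETS_def')

lemma module_quotient:
  assumes H: "submodule H R M"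
  shows "module R (quotient_module M H)"
proof -
  interpret H: abelian_subgroup H M by (rule submodule_imp_abelian_subgroup) fact
  have "comm_group (add_monoid (quotient_module M H))"
    by (rule comm_group_cong[OF H.a_factorgroup_is_comm_group])
       (simp_all add: quotient_module_def A_FactGroup_def FactGroup_def A_RCOSETS_def set_add_def)
  hence "abelian_group (quotient_module M H)"
    by (intro abelian_group.intro abelian_monoid.intro abelian_group_axioms.intro)
       (simp_all add: comm_group.axioms)
  thus ?thesis
    by (intro moduleI R.cring_axioms)
       (auto simp: quotient_carrier quotient_add[OF H] quotient_smult[OF H] smult_l_distr
          smult_r_distr smult_assoc1)
qed

text \<open>Since \<open>f\<close> kills \<open>H\<close>, the image of the coset is the singleton
  \<open>{f x}\<close>, from which \<open>the_elem\<close> reads off the value.\<close>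

lemma induced_coset:
  assumes H: "submodule H R M" and W: "module R W" and f: "f \<in> linear_maps R M W"
    and 0: "\<And>x. x \<in> H \<Longrightarrow> f x = \<zero>\<^bsub>W\<^esub>" and x: "x \<in> carrier M"
  shows "induced f (H +>\<^bsub>M\<^esub> x) = f x"
proof -
  interpret H: abelian_subgroup H M by (rule submodule_imp_abelian_subgroup) fact
  interpret W: module R W by fact
  have "f (h \<oplus>\<^bsub>M\<^esub> x) = f x" if "h \<in> H" for h
    using that x 0[OF that] by (simp add: linear_mapsD[OF f])
  hence "f ` (H +>\<^bsub>M\<^esub> x) = {f x}"
    using H.a_rcos_self[OF x] by (auto simp: a_r_coset_def')
  thus ?thesis by (simp add: induced_def)
qed

lemma induced_linear:
  assumes H: "submodule H R M" and W: "module R W" and f: "f \<in> linear_maps R M W"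
    and 0: "\<And>x. x \<in> H \<Longrightarrow> f x = \<zero>\<^bsub>W\<^esub>"
  shows "induced f \<in> linear_maps R (quotient_module M H) W"
  by (rule linear_mapsI)
     (auto simp: quotient_carrier quotient_add[OF H] quotient_smult[OF H] induced_coset[OF assms]
        linear_mapsD[OF f])

end

text \<open>The universal property behind the projection, the comultiplication and
  \<open>tensor_map\<close>: a map out of a quotient by generated relations need only be checked on
  the generators.\<close>

lemma induced_generated_linear:
  assumes V: "module K V" and W: "module K W" and f: "f \<in> linear_maps K V W"
    and S: "S \<subseteq> carrier V" and 0: "\<And>x. x \<in> S \<Longrightarrow> f x = \<zero>\<^bsub>W\<^esub>"
  shows "induced f \<in> linear_maps K (quotient_module V (generated_submodule K V S)) W"
  using module.induced_linear[OF V module.generated_submodule_is_submodule[OF V S] W f]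
    linear_maps_generated_submodule[OF V W f S 0] by blast

section \<open>Free modules and linear extension\<close>

lemma free_module_is_module:
  assumes "cring K" shows "module K (free_module K X)"
proof -
  interpret K: cring K by fact
  let ?F = "free_module K X"
  have cl: "f x \<in> carrier K" if "f \<in> carrier ?F" for f x
    using that by (cases "x \<in> X") (auto simp: free_module_def)
  have supp: "finite {x. f x \<noteq> \<zero>\<^bsub>K\<^esub>}" if "f \<in> carrier ?F" for f
    using that by (auto simp: free_module_def)
  have memI: "f \<in> carrier ?F" if "\<And>x. x \<in> X \<Longrightarrow> f x \<in> carrier K" "\<And>x. x \<notin> X \<Longrightarrow> f x = \<zero>\<^bsub>K\<^esub>"
    "finite {x. f x \<noteq> \<zero>\<^bsub>K\<^esub>}" for f
    using that by (auto simp: free_module_def)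
  have out: "f x = \<zero>\<^bsub>K\<^esub>" if "f \<in> carrier ?F" "x \<notin> X" for f x
    using that by (auto simp: free_module_def)
  have add: "f \<oplus>\<^bsub>?F\<^esub> g = (\<lambda>x. f x \<oplus>\<^bsub>K\<^esub> g x)" for f g by (simp add: free_module_def)
  have sm: "c \<odot>\<^bsub>?F\<^esub> g = (\<lambda>x. c \<otimes>\<^bsub>K\<^esub> g x)" for c g by (simp add: free_module_def)
  have z: "\<zero>\<^bsub>?F\<^esub> = (\<lambda>x. \<zero>\<^bsub>K\<^esub>)" by (simp add: free_module_def)
  have addcl: "f \<oplus>\<^bsub>?F\<^esub> g \<in> carrier ?F" if "f \<in> carrier ?F" "g \<in> carrier ?F" for f g
    unfolding add
  proof (rule memI)
    show "finite {x. f x \<oplus>\<^bsub>K\<^esub> g x \<noteq> \<zero>\<^bsub>K\<^esub>}"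
      by (rule finite_subset[OF _ finite_UnI[OF supp[OF that(1)] supp[OF that(2)]]]) auto
  qed (use that in \<open>simp_all add: cl out\<close>)
  have smcl: "c \<odot>\<^bsub>?F\<^esub> f \<in> carrier ?F" if "f \<in> carrier ?F" "c \<in> carrier K" for f c
    unfolding sm
  proof (rule memI)
    show "finite {x. c \<otimes>\<^bsub>K\<^esub> f x \<noteq> \<zero>\<^bsub>K\<^esub>}"
      by (rule finite_subset[OF _ supp[OF that(1)]]) (use that in auto)
  qed (use that in \<open>simp_all add: cl out\<close>)
  have zcl: "\<zero>\<^bsub>?F\<^esub> \<in> carrier ?F" unfolding z by (rule memI) auto
  have "abelian_group ?F"
  proof (rule abelian_groupI)
    fix f assume f: "f \<in> carrier ?F"
    show "\<exists>g\<in>carrier ?F. g \<oplus>\<^bsub>?F\<^esub> f = \<zero>\<^bsub>?F\<^esub>"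
    proof
      \<comment> \<open>Taking the inverse as a scalar multiple gets its finite support from
        \<open>smcl\<close>.\<close>
      show "(\<ominus>\<^bsub>K\<^esub> \<one>\<^bsub>K\<^esub>) \<odot>\<^bsub>?F\<^esub> f \<in> carrier ?F" by (simp add: smcl f)
      show "(\<ominus>\<^bsub>K\<^esub> \<one>\<^bsub>K\<^esub>) \<odot>\<^bsub>?F\<^esub> f \<oplus>\<^bsub>?F\<^esub> f = \<zero>\<^bsub>?F\<^esub>"
        by (simp add: add sm z cl f K.l_minus K.l_neg)
    qed
  next
    fix f g h assume "f \<in> carrier ?F" "g \<in> carrier ?F" "h \<in> carrier ?F"
    thus "f \<oplus>\<^bsub>?F\<^esub> g \<oplus>\<^bsub>?F\<^esub> h = f \<oplus>\<^bsub>?F\<^esub> (g \<oplus>\<^bsub>?F\<^esub> h)"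
      by (simp add: add cl K.a_assoc)
  next
    fix f g assume "f \<in> carrier ?F" "g \<in> carrier ?F"
    thus "f \<oplus>\<^bsub>?F\<^esub> g = g \<oplus>\<^bsub>?F\<^esub> f"
      by (simp add: add cl K.a_comm)
  next
    fix f assume "f \<in> carrier ?F"
    thus "\<zero>\<^bsub>?F\<^esub> \<oplus>\<^bsub>?F\<^esub> f = f" by (simp add: add z cl)
  qed (auto intro: addcl zcl)
  thus ?thesis
    by (intro moduleI assms)
       (simp_all add: addcl smcl,
        simp_all add: add sm cl K.l_distr K.r_distr K.m_assoc)
qed

lemma basis_vector_closed:
  assumes "cring K" "x \<in> X" shows "basis_vector K x \<in> carrier (free_module K X)"
proof -
  interpret K: cring K by fact
  have "finite {y. basis_vector K x y \<noteq> \<zero>\<^bsub>K\<^esub>}"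
    by (rule finite_subset[of _ "{x}"]) (auto simp: basis_vector_def)
  with assms(2) show ?thesis by (auto simp: free_module_def basis_vector_def)
qed

text \<open>The defining sum runs over the support, which differs between two functions and their
  sum. Terms outside the support vanish, so all three can be summed over one common finite
  set.\<close>

lemma linear_extension_supset:
  assumes W: "module K W" and g: "g \<in> X \<rightarrow> carrier W" and f: "f \<in> carrier (free_module K X)"
    and B: "finite B" "{x. f x \<noteq> \<zero>\<^bsub>K\<^esub>} \<subseteq> B" "B \<subseteq> X"
  shows "linear_extension K W g f = (\<Oplus>\<^bsub>W\<^esub>x\<in>B. f x \<odot>\<^bsub>W\<^esub> g x)"
proof -
  interpret W: module K W by fact
  have fB: "f x \<in> carrier K" if "x \<in> B" for x using f B that by (auto simp: free_module_def)
  have gB: "g x \<in> carrier W" if "x \<in> B" for x using g B that by auto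
  show ?thesis unfolding linear_extension_def
    by (rule W.add.finprod_mono_neutral_cong_left)
       (use B fB gB in auto)
qed

lemma linear_extension_linear:
  fixes K :: "('k, 'r) ring_scheme" and W :: "('k, 'w, 's) module_scheme" and X :: "'x set"
  assumes W: "module K W" and g: "g \<in> X \<rightarrow> carrier W"
  shows "linear_extension K W g \<in> linear_maps K (free_module K X) W"
proof (rule linear_mapsI)
  interpret W: module K W by fact
  let ?F = "free_module K X"
  interpret F: module K ?F by (rule free_module_is_module) unfold_locales
  define S where "S f = {x. f x \<noteq> \<zero>\<^bsub>K\<^esub>}" for f :: "'x \<Rightarrow> 'k"
  have S: "finite (S f)" "S f \<subseteq> X" if "f \<in> carrier ?F" for f
    using that by (auto simp: S_def free_module_def)
  have fc: "f x \<in> carrier K" if "f \<in> carrier ?F" "x \<in> X" for f x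
    using that by (auto simp: free_module_def)
  have gc: "g x \<in> carrier W" if "x \<in> X" for x using g that by auto
  note le = linear_extension_supset[OF W g, folded S_def]
  fix f assume f: "f \<in> carrier ?F"
  show "linear_extension K W g f \<in> carrier W"
    unfolding le[OF f S(1)[OF f] order_refl S(2)[OF f]]
    by (rule W.finsum_closed) (use S(2)[OF f] fc[OF f] gc in auto)
  {
    fix h assume h: "h \<in> carrier ?F"
    let ?B = "S f \<union> S h"
    have fh: "f \<oplus>\<^bsub>?F\<^esub> h = (\<lambda>x. f x \<oplus>\<^bsub>K\<^esub> h x)" by (simp add: free_module_def)
    have B: "finite ?B" "?B \<subseteq> X" using S f h by auto
    have "S (f \<oplus>\<^bsub>?F\<^esub> h) \<subseteq> ?B" by (auto simp: S_def fh)
    hence "linear_extension K W g (f \<oplus>\<^bsub>?F\<^esub> h) = (\<Oplus>\<^bsub>W\<^esub>x\<in>?B. (f \<oplus>\<^bsub>?F\<^esub> h) x \<odot>\<^bsub>W\<^esub> g x)"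
      using B f h by (intro le) auto
    also have "\<dots> = (\<Oplus>\<^bsub>W\<^esub>x\<in>?B. f x \<odot>\<^bsub>W\<^esub> g x \<oplus>\<^bsub>W\<^esub> h x \<odot>\<^bsub>W\<^esub> g x)"
      by (rule W.finsum_cong') (use B fc[OF f] fc[OF h] gc in \<open>auto simp: fh W.smult_l_distr subset_iff\<close>)
    also have "\<dots> = (\<Oplus>\<^bsub>W\<^esub>x\<in>?B. f x \<odot>\<^bsub>W\<^esub> g x) \<oplus>\<^bsub>W\<^esub> (\<Oplus>\<^bsub>W\<^esub>x\<in>?B. h x \<odot>\<^bsub>W\<^esub> g x)"
      by (rule W.finsum_addf) (use B fc[OF f] fc[OF h] gc in auto)
    also have "\<dots> = linear_extension K W g f \<oplus>\<^bsub>W\<^esub> linear_extension K W g h"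
      using B f h by (subst (1 2) le[of _ ?B]) auto
    finally show "linear_extension K W g (f \<oplus>\<^bsub>?F\<^esub> h) = \<dots>" .
  }
  fix c assume c: "c \<in> carrier K"
  have cf: "c \<odot>\<^bsub>?F\<^esub> f = (\<lambda>x. c \<otimes>\<^bsub>K\<^esub> f x)" by (simp add: free_module_def)
  have "S (c \<odot>\<^bsub>?F\<^esub> f) \<subseteq> S f" using c by (auto simp: S_def cf)
  hence "linear_extension K W g (c \<odot>\<^bsub>?F\<^esub> f) = (\<Oplus>\<^bsub>W\<^esub>x\<in>S f. (c \<odot>\<^bsub>?F\<^esub> f) x \<odot>\<^bsub>W\<^esub> g x)"
    using S[OF f] f c by (intro le) auto
  also have "\<dots> = (\<Oplus>\<^bsub>W\<^esub>x\<in>S f. c \<odot>\<^bsub>W\<^esub> (f x \<odot>\<^bsub>W\<^esub> g x))"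
    by (rule W.finsum_cong') (use S[OF f] fc[OF f] gc c in \<open>auto simp: cf W.smult_assoc1 subset_iff\<close>)
  also have "\<dots> = c \<odot>\<^bsub>W\<^esub> (\<Oplus>\<^bsub>W\<^esub>x\<in>S f. f x \<odot>\<^bsub>W\<^esub> g x)"
    by (rule W.finsum_smult_ldistr[symmetric]) (use S[OF f] fc[OF f] gc c in auto)
  finally show "linear_extension K W g (c \<odot>\<^bsub>?F\<^esub> f) = c \<odot>\<^bsub>W\<^esub> linear_extension K W g f"
    using S[OF f] f by (subst (2) le[of _ "S f"]) auto
qed

lemma linear_extension_basis_vector:
  assumes W: "module K W" and g: "g \<in> X \<rightarrow> carrier W" and x: "x \<in> X"
  shows "linear_extension K W g (basis_vector K x) = g x"
proof -
  interpret W: module K W by fact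
  have gx: "g x \<in> carrier W" using g x by auto
  have "linear_extension K W g (basis_vector K x) = (\<Oplus>\<^bsub>W\<^esub>y\<in>{x}. basis_vector K x y \<odot>\<^bsub>W\<^esub> g y)"
    using x by (intro linear_extension_supset[OF W g] basis_vector_closed)
      (auto simp: basis_vector_def W.cring_axioms)
  thus ?thesis using gx by (simp add: basis_vector_def)
qed

section \<open>Tensor products\<close>

lemma (in abelian_group) minus_eq_zero_iff:
  "x \<in> carrier G \<Longrightarrow> y \<in> carrier G \<Longrightarrow> x \<ominus> y = \<zero> \<longleftrightarrow> x = y"
  by (simp add: a_minus_def) (metis a_inv_closed minus_equality minus_minus r_neg)

lemma tensor_relations_closed:
  assumes V: "module K V" and W: "module K W"
  shows "tensor_relations K V W \<subseteq> carrier (free_module K (carrier V \<times> carrier W))"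
proof -
  interpret V: module K V by fact
  interpret W: module K W by fact
  interpret F: module K "free_module K (carrier V \<times> carrier W)"
    by (rule free_module_is_module) unfold_locales
  have "basis_vector K (x, y) \<in> carrier (free_module K (carrier V \<times> carrier W))"
    if "x \<in> carrier V" "y \<in> carrier W" for x y
    using that by (intro basis_vector_closed) (auto intro: V.R.cring_axioms)
  thus ?thesis by (auto simp: tensor_relations_def Let_def)
qed

lemma tensor_kernel_submodule:
  assumes V: "module K V" and W: "module K W"
  shows "submodule (tensor_kernel K V W) K (free_module K (carrier V \<times> carrier W))"
proof -
  interpret V: module K V by fact
  show ?thesis unfolding tensor_kernel_def
    by (intro module.generated_submodule_is_submodule free_module_is_module
        tensor_relations_closed V W V.R.cring_axioms)
qed

lemma module_tensor_product:
  assumes V: "module K V" and W: "module K W"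
  shows "module K (tensor_product K V W)"
proof -
  interpret V: module K V by fact
  show ?thesis unfolding tensor_product_def
    by (intro module.module_quotient free_module_is_module tensor_kernel_submodule V W
        V.R.cring_axioms)
qed

text \<open>Each bilinearity rule is an equality of cosets, that is, membership of a difference in
  \<open>tensor_kernel\<close>; that difference is one of the generators.\<close>

lemma
  assumes V: "module K V" and W: "module K W"
  shows pure_tensor_closed:
      "x \<in> carrier V \<Longrightarrow> y \<in> carrier W \<Longrightarrow> pure_tensor K V W x y \<in> carrier (tensor_product K V W)"
    and pure_tensor_add_left:
      "x \<in> carrier V \<Longrightarrow> x' \<in> carrier V \<Longrightarrow> y \<in> carrier W \<Longrightarrow>
        pure_tensor K V W (x \<oplus>\<^bsub>V\<^esub> x') y =
        pure_tensor K V W x y \<oplus>\<^bsub>tensor_product K V W\<^esub> pure_tensor K V W x' y"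
    and pure_tensor_add_right:
      "x \<in> carrier V \<Longrightarrow> y \<in> carrier W \<Longrightarrow> y' \<in> carrier W \<Longrightarrow>
        pure_tensor K V W x (y \<oplus>\<^bsub>W\<^esub> y') =
        pure_tensor K V W x y \<oplus>\<^bsub>tensor_product K V W\<^esub> pure_tensor K V W x y'"
    and pure_tensor_smult_left:
      "c \<in> carrier K \<Longrightarrow> x \<in> carrier V \<Longrightarrow> y \<in> carrier W \<Longrightarrow>
        pure_tensor K V W (c \<odot>\<^bsub>V\<^esub> x) y = c \<odot>\<^bsub>tensor_product K V W\<^esub> pure_tensor K V W x y"
    and pure_tensor_smult_right:
      "c \<in> carrier K \<Longrightarrow> x \<in> carrier V \<Longrightarrow> y \<in> carrier W \<Longrightarrow>
        pure_tensor K V W x (c \<odot>\<^bsub>W\<^esub> y) = c \<odot>\<^bsub>tensor_product K V W\<^esub> pure_tensor K V W x y"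
proof -
  interpret V: module K V by fact
  interpret W: module K W by fact
  let ?F = "free_module K (carrier V \<times> carrier W)"
  interpret F: module K ?F
    by (rule free_module_is_module) unfold_locales
  have e: "basis_vector K (x, y) \<in> carrier ?F" if "x \<in> carrier V" "y \<in> carrier W" for x y
    using that by (intro basis_vector_closed) (auto intro: V.R.cring_axioms)
  note N = tensor_kernel_submodule[OF V W]
  note defs = tensor_product_def pure_tensor_def
  note simps = defs F.quotient_add[OF N] F.quotient_smult[OF N] F.quotient_coset_eq_iff[OF N]
  have R: "r \<in> tensor_kernel K V W" if "r \<in> tensor_relations K V W" for r
    unfolding tensor_kernel_def by (rule subsetD[OF generated_submodule_incl that])
  show "pure_tensor K V W x y \<in> carrier (tensor_product K V W)"
    if "x \<in> carrier V" "y \<in> carrier W"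
    unfolding defs F.quotient_carrier by (rule imageI) (rule e[OF that])
  show "pure_tensor K V W (x \<oplus>\<^bsub>V\<^esub> x') y =
      pure_tensor K V W x y \<oplus>\<^bsub>tensor_product K V W\<^esub> pure_tensor K V W x' y"
    if "x \<in> carrier V" "x' \<in> carrier V" "y \<in> carrier W"
  proof -
    have "basis_vector K (x \<oplus>\<^bsub>V\<^esub> x', y) \<ominus>\<^bsub>?F\<^esub> (basis_vector K (x, y) \<oplus>\<^bsub>?F\<^esub> basis_vector K (x', y))
        \<in> tensor_relations K V W"
      unfolding tensor_relations_def Let_def using that by blast
    from R[OF this] show ?thesis using that by (simp add: simps e)
  qed
  show "pure_tensor K V W x (y \<oplus>\<^bsub>W\<^esub> y') =
      pure_tensor K V W x y \<oplus>\<^bsub>tensor_product K V W\<^esub> pure_tensor K V W x y'"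
    if "x \<in> carrier V" "y \<in> carrier W" "y' \<in> carrier W"
  proof -
    have "basis_vector K (x, y \<oplus>\<^bsub>W\<^esub> y') \<ominus>\<^bsub>?F\<^esub> (basis_vector K (x, y) \<oplus>\<^bsub>?F\<^esub> basis_vector K (x, y'))
        \<in> tensor_relations K V W"
      unfolding tensor_relations_def Let_def using that by blast
    from R[OF this] show ?thesis using that by (simp add: simps e)
  qed
  show "pure_tensor K V W (c \<odot>\<^bsub>V\<^esub> x) y = c \<odot>\<^bsub>tensor_product K V W\<^esub> pure_tensor K V W x y"
    if "c \<in> carrier K" "x \<in> carrier V" "y \<in> carrier W"
  proof -
    have "basis_vector K (c \<odot>\<^bsub>V\<^esub> x, y) \<ominus>\<^bsub>?F\<^esub> c \<odot>\<^bsub>?F\<^esub> basis_vector K (x, y)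
        \<in> tensor_relations K V W"
      unfolding tensor_relations_def Let_def using that by blast
    from R[OF this] show ?thesis using that by (simp add: simps e)
  qed
  show "pure_tensor K V W x (c \<odot>\<^bsub>W\<^esub> y) = c \<odot>\<^bsub>tensor_product K V W\<^esub> pure_tensor K V W x y"
    if "c \<in> carrier K" "x \<in> carrier V" "y \<in> carrier W"
  proof -
    have "basis_vector K (x, c \<odot>\<^bsub>W\<^esub> y) \<ominus>\<^bsub>?F\<^esub> c \<odot>\<^bsub>?F\<^esub> basis_vector K (x, y)
        \<in> tensor_relations K V W"
      unfolding tensor_relations_def Let_def using that by blast
    from R[OF this] show ?thesis using that by (simp add: simps e)
  qed
qed

text \<open>As \<open>f\<close> and \<open>g\<close> are linear and pure tensors are bilinear, the
  extension of \<open>(x, y) \<mapsto> f x \<otimes> g y\<close> kills each of the four families of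
  tensor relations.\<close>

lemma tensor_map_linear:
  assumes V: "module K V" and W: "module K W" and V': "module K V'" and W': "module K W'"
    and f: "f \<in> linear_maps K V V'" and g: "g \<in> linear_maps K W W'"
  shows "tensor_map K V' W' f g \<in> linear_maps K (tensor_product K V W) (tensor_product K V' W')"
proof -
  interpret V: module K V by fact
  interpret W: module K W by fact
  let ?F = "free_module K (carrier V \<times> carrier W)" and ?T = "tensor_product K V' W'"
  interpret T: module K ?T by (rule module_tensor_product[OF V' W'])
  have F: "module K ?F" by (rule free_module_is_module) unfold_locales
  interpret F: module K ?F by fact
  define \<phi> where "\<phi> = (\<lambda>(x, y). pure_tensor K V' W' (f x) (g y))"
  have \<phi>: "\<phi> \<in> carrier V \<times> carrier W \<rightarrow> carrier ?T"
    by (auto simp: \<phi>_def linear_mapsD[OF f] linear_mapsD[OF g] pure_tensor_closed[OF V' W'])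
  define L where "L = linear_extension K ?T \<phi>"
  have L: "L \<in> linear_maps K ?F ?T"
    unfolding L_def by (rule linear_extension_linear[OF T.module_axioms \<phi>])
  have Le: "L (basis_vector K (x, y)) = pure_tensor K V' W' (f x) (g y)"
    if "x \<in> carrier V" "y \<in> carrier W" for x y
    using linear_extension_basis_vector[OF T.module_axioms \<phi>] that by (simp add: L_def \<phi>_def)
  have e: "basis_vector K (x, y) \<in> carrier ?F" if "x \<in> carrier V" "y \<in> carrier W" for x y
    using that by (intro basis_vector_closed) (auto intro: V.R.cring_axioms)
  note lin = linear_mapsD[OF L] linear_maps_minus[OF F T.module_axioms L] linear_mapsD[OF f]
    linear_mapsD[OF g] pure_tensor_closed[OF V' W'] pure_tensor_add_left[OF V' W']
    pure_tensor_add_right[OF V' W'] pure_tensor_smult_left[OF V' W']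
    pure_tensor_smult_right[OF V' W']
  have "L r = \<zero>\<^bsub>?T\<^esub>" if "r \<in> tensor_relations K V W" for r
    using that unfolding tensor_relations_def Let_def
    by (elim UnE CollectE exE conjE) (simp_all add: lin e Le T.minus_eq_zero_iff)
  from induced_generated_linear[OF F T.module_axioms L tensor_relations_closed[OF V W] this]
  show ?thesis
    by (simp add: tensor_map_def tensor_product_def tensor_kernel_def L_def \<phi>_def)
qed

section \<open>Diffeomorphisms of the circle\<close>

text \<open>Derivatives of products, composites and inverses involve the functions themselves again.
  A finite order that drops by one at each derivative gives the closure properties a variable for
  induction; smoothness is \<open>ndiff n\<close> for all \<open>n\<close>.\<close>

primrec ndiff :: "nat \<Rightarrow> (real \<Rightarrow> real) \<Rightarrow> bool" where
  "ndiff 0 f \<longleftrightarrow> True"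
| "ndiff (Suc n) f \<longleftrightarrow> (\<forall>t. f field_differentiable at t) \<and> ndiff n (deriv f)"

lemma ndiff_iff: "ndiff n f \<longleftrightarrow> (\<forall>m<n. \<forall>t. (deriv ^^ m) f field_differentiable at t)"
  by (induction n arbitrary: f) (auto simp: All_less_Suc2 funpow_swap1)

lemma smooth_real_iff_ndiff: "smooth_real f \<longleftrightarrow> (\<forall>n. ndiff n f)"
  unfolding smooth_real_def ndiff_iff by blast

lemma ndiff_Suc_imp: "ndiff (Suc n) f \<Longrightarrow> ndiff n f"
  unfolding ndiff_iff by simp

lemma ndiff_SucI:
  assumes "\<And>t. (f has_real_derivative f' t) (at t)" "ndiff n f'"
  shows "ndiff (Suc n) f"
proof -
  have "deriv f = f'" using assms(1) by (auto intro: DERIV_imp_deriv)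
  thus ?thesis using assms by (auto simp: field_differentiable_def)
qed

lemma ndiff_deriv: "ndiff (Suc n) f \<Longrightarrow> (f has_real_derivative deriv f t) (at t)"
  by (auto intro: field_differentiable_derivI)

lemma ndiff_const: "ndiff n (\<lambda>t. c)"
  by (induction n arbitrary: c) (auto simp: deriv_const)

lemma ndiff_id: "ndiff n (\<lambda>t. t)"
  by (cases n) (auto simp: field_differentiable_ident ndiff_const)

lemma ndiff_add: "ndiff n f \<Longrightarrow> ndiff n g \<Longrightarrow> ndiff n (\<lambda>t. f t + g t)"
proof (induction n arbitrary: f g)
  case (Suc n)
  show ?case
    by (rule ndiff_SucI[where f' = "\<lambda>t. deriv f t + deriv g t"])
       (use Suc in \<open>auto intro!: DERIV_add ndiff_deriv[of n]\<close>)
qed auto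

lemma ndiff_mult: "ndiff n f \<Longrightarrow> ndiff n g \<Longrightarrow> ndiff n (\<lambda>t. f t * g t)"
proof (induction n arbitrary: f g)
  case (Suc n)
  show ?case
  proof (rule ndiff_SucI[where f' = "\<lambda>t. deriv f t * g t + deriv g t * f t"])
    show "((\<lambda>t. f t * g t) has_real_derivative deriv f t * g t + deriv g t * f t) (at t)" for t
      using DERIV_mult[OF ndiff_deriv[OF Suc.prems(1)] ndiff_deriv[OF Suc.prems(2)]] .
    show "ndiff n (\<lambda>t. deriv f t * g t + deriv g t * f t)"
      using Suc.prems by (intro ndiff_add Suc.IH) (auto simp: ndiff_Suc_imp[OF Suc.prems(1)] ndiff_Suc_imp[OF Suc.prems(2)])
  qed
qed auto

lemma ndiff_compose: "ndiff n f \<Longrightarrow> ndiff n g \<Longrightarrow> ndiff n (\<lambda>t. f (g t))"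
proof (induction n arbitrary: f g)
  case (Suc n)
  show ?case
  proof (rule ndiff_SucI[where f' = "\<lambda>t. deriv f (g t) * deriv g t"])
    show "((\<lambda>t. f (g t)) has_real_derivative deriv f (g t) * deriv g t) (at t)" for t
      using DERIV_chain2[OF ndiff_deriv[OF Suc.prems(1)] ndiff_deriv[OF Suc.prems(2)]] .
    show "ndiff n (\<lambda>t. deriv f (g t) * deriv g t)"
      using Suc.prems Suc.IH[of "deriv f" g] ndiff_Suc_imp[OF Suc.prems(2)]
      by (intro ndiff_mult) auto
  qed
qed auto

lemma ndiff_inverse: "ndiff n f \<Longrightarrow> (\<And>t. f t \<noteq> 0) \<Longrightarrow> ndiff n (\<lambda>t. inverse (f t))"
proof (induction n)
  case (Suc n)
  have inv: "ndiff n (\<lambda>t. inverse (f t))"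
    using Suc.IH[OF ndiff_Suc_imp[OF Suc.prems(1)] Suc.prems(2)] .
  show ?case
  \<comment> \<open>The derivative \<open>- f' / f^2\<close> is written as a product, so that the
    induction hypothesis for the reciprocal and closure under products suffice.\<close>
  proof (rule ndiff_SucI[where f' = "\<lambda>t. -1 * (inverse (f t) * deriv f t * inverse (f t))"])
    show "((\<lambda>t. inverse (f t)) has_real_derivative -1 * (inverse (f t) * deriv f t * inverse (f t)))
        (at t)" for t
      using DERIV_inverse'[OF ndiff_deriv[OF Suc.prems(1)] Suc.prems(2)[of t]] by simp
    show "ndiff n (\<lambda>t. -1 * (inverse (f t) * deriv f t * inverse (f t)))"
      using Suc.prems(1) inv by (intro ndiff_mult ndiff_const) auto
  qed
qed auto

text \<open>Bootstrapping: the derivative of \<open>g\<close> is the reciprocal of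
  \<open>deriv f\<close> composed with \<open>g\<close>, so order \<open>n\<close> for
  \<open>g\<close> gives order \<open>n\<close> for its derivative, which is order
  \<open>Suc n\<close> for \<open>g\<close>.\<close>

lemma ndiff_inverse_function:
  assumes f: "\<And>n. ndiff n f" and pos: "\<And>t. deriv f t > 0"
    and gf: "\<And>t. g (f t) = t" and fg: "\<And>t. f (g t) = t"
  shows "ndiff n g"
proof (induction n)
  case (Suc n)
  have df: "(f has_real_derivative deriv f t) (at t)" for t using f ndiff_deriv by blast
  have nz: "deriv f t \<noteq> 0" for t using pos[of t] by simp
  have "continuous_on UNIV f"
    using df by (meson DERIV_isCont continuous_at_imp_continuous_on)
  hence "(g has_real_derivative inverse (deriv f (g t))) (at (f (g t)))" for t
    using df[of "g t"] gf nz[of "g t"] unfolding has_field_derivative_def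
    by (intro has_derivative_inverse_strong[of UNIV "g t" f g]) (auto simp: o_def fun_eq_iff)
  moreover have "ndiff n (\<lambda>t. inverse (deriv f (g t)))"
    using f[of "Suc n"] Suc nz ndiff_compose[of n "deriv f" g] by (intro ndiff_inverse) auto
  ultimately show ?case by (intro ndiff_SucI[where f' = "\<lambda>t. inverse (deriv f (g t))"]) (auto simp: fg)
qed auto

text \<open>Proved jointly, since each of the two functions is the derivative of the other up to
  sign.\<close>

lemma ndiff_sin_cos: "ndiff n sin \<and> ndiff n cos"
proof (induction n)
  case (Suc n)
  have "ndiff n (\<lambda>t. -1 * sin t)" using Suc by (intro ndiff_mult ndiff_const) auto
  thus ?case using Suc
    by (auto intro!: ndiff_SucI[of sin cos] ndiff_SucI[of cos "\<lambda>t. -1 * sin t"] derivative_eq_intros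
          simp del: ndiff.simps)
qed auto

section \<open>Composition, lifting and inversion of circle diffeomorphisms\<close>

lemma oriented_circle_diffeo_comp:
  assumes "oriented_circle_diffeo h" "oriented_circle_diffeo k"
  shows "oriented_circle_diffeo (h \<circ> k)"
proof -
  obtain f where f: "\<And>n. ndiff n f" "\<And>t. deriv f t > 0" "\<And>t. f (t + 2 * pi) = f t + 2 * pi"
    "\<And>t. h (cis t) = cis (f t)"
    using assms(1) by (auto simp: oriented_circle_diffeo_def smooth_real_iff_ndiff)
  obtain g where g: "\<And>n. ndiff n g" "\<And>t. deriv g t > 0" "\<And>t. g (t + 2 * pi) = g t + 2 * pi"
    "\<And>t. k (cis t) = cis (g t)"
    using assms(2) by (auto simp: oriented_circle_diffeo_def smooth_real_iff_ndiff)
  have "deriv (\<lambda>t. f (g t)) t = deriv f (g t) * deriv g t" for t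
    using DERIV_chain2[OF ndiff_deriv[OF f(1)] ndiff_deriv[OF g(1)]] by (rule DERIV_imp_deriv)
  thus ?thesis unfolding oriented_circle_diffeo_def
    using ndiff_compose[OF f(1) g(1)]
    by (intro exI[of _ "\<lambda>t. f (g t)"]) (auto simp: smooth_real_iff_ndiff f g)
qed

lemma shift_equivariant_int:
  fixes f :: "real \<Rightarrow> real"
  assumes "\<And>t. f (t + 2 * pi) = f t + 2 * pi"
  shows "f (t + 2 * pi * of_int n) = f t + 2 * pi * of_int n"
proof (induction n rule: int_induct[of _ 0])
  case (step1 i)
  then show ?case using assms[of "t + 2 * pi * of_int i"] by (simp add: algebra_simps)
next
  case (step2 i)
  then show ?case using assms[of "t + 2 * pi * of_int (i - 1)"] by (simp add: algebra_simps)
qed auto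

lemma cis_eq_iff: "cis s = cis t \<longleftrightarrow> (\<exists>n::int. s = t + 2 * pi * of_int n)"
  using sin_cos_eq_iff[of s t] by (auto simp: complex_eq_iff)

text \<open>Two angles of one point differ by a multiple of \<open>2 * pi\<close>, and
  \<open>f\<close> respects such shifts, so the angle chosen by \<open>SOME\<close> does not affect
  \<open>cis (f s)\<close>.\<close>

lemma oriented_circle_diffeo_of_lift:
  assumes "\<And>n. ndiff n f" "\<And>t. deriv f t > 0" "\<And>t. f (t + 2 * pi) = f t + 2 * pi"
  obtains h where "oriented_circle_diffeo h" "\<And>t. h (cis t) = cis (f t)"
proof
  have "cis (f s) = cis (f t)" if "cis s = cis t" for s t
    using that shift_equivariant_int[of f, OF assms(3)] by (metis cis_eq_iff)
  hence *: "cis (f (SOME s. cis s = cis t)) = cis (f t)" for t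
    by (metis (mono_tags, lifting) someI)
  thus "oriented_circle_diffeo (\<lambda>z. cis (f (SOME s. cis s = z)))"
    using assms unfolding oriented_circle_diffeo_def smooth_real_iff_ndiff by blast
  show "cis (f (SOME s. cis s = cis t)) = cis (f t)" for t by (rule *)
qed

lemma in_circle_iff: "z \<in> sphere 0 1 \<longleftrightarrow> (\<exists>t. z = cis t)"
  by (metis cis_Arg_unique dist_0_norm mem_sphere norm_cis rcis_cmod_Arg rcis_def mult_1 of_real_1)

text \<open>The lift is strictly increasing and, by its equivariance, unbounded in both directions,
  hence a bijection of the line whose inverse is again a lift. The conclusion is confined to the
  circle because \<open>h\<close> is arbitrary elsewhere.\<close>

lemma oriented_circle_diffeo_inverse:
  assumes "oriented_circle_diffeo h"
  obtains k where "oriented_circle_diffeo k" "\<And>z. z \<in> sphere 0 1 \<Longrightarrow> k (h z) = z"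
proof -
  obtain f where f: "\<And>n. ndiff n f" "\<And>t. deriv f t > 0" "\<And>t. f (t + 2 * pi) = f t + 2 * pi"
    "\<And>t. h (cis t) = cis (f t)"
    using assms by (auto simp: oriented_circle_diffeo_def smooth_real_iff_ndiff)
  have df: "(f has_real_derivative deriv f t) (at t)" for t using f(1) ndiff_deriv by blast
  have mono: "f s < f t" if "s < t" for s t
    using that df f(2) by (metis DERIV_pos_imp_increasing)
  have inj: "inj f"
    using mono by (metis injI linorder_cases order_less_irrefl)
  have "\<exists>x. f x = y" for y
  proof -
    \<comment> \<open>So many full turns that the values of \<open>f\<close> at
      \<open>- (2 * pi * n)\<close> and \<open>2 * pi * n\<close> enclose \<open>y\<close>, as the
      intermediate value theorem requires.\<close>
    define n where "n = \<lceil>\<bar>y - f 0\<bar> / (2 * pi)\<rceil>"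
    have n: "\<bar>y - f 0\<bar> \<le> 2 * pi * of_int n"
      using le_of_int_ceiling[of "\<bar>y - f 0\<bar> / (2 * pi)"] unfolding n_def
      by (subst (asm) pos_divide_le_eq) (simp_all add: mult.commute)
    have "f (2 * pi * of_int n) = f 0 + 2 * pi * of_int n"
      "f (- (2 * pi * of_int n)) = f 0 - 2 * pi * of_int n"
      using shift_equivariant_int[of f 0 n, OF f(3)] shift_equivariant_int[of f 0 "-n", OF f(3)] by auto
    moreover have "continuous_on S f" for S
      using df by (meson DERIV_isCont continuous_at_imp_continuous_on)
    ultimately show ?thesis
      using n IVT'[of f "- (2 * pi * of_int n)" y "2 * pi * of_int n"] by fastforce
  qed
  hence surj: "surj f" by (metis surj_def)
  define g where "g = inv_into UNIV f"
  have fg: "f (g y) = y" for y using surj unfolding g_def by (rule surj_f_inv_f)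
  have gf: "g (f t) = t" for t using inj unfolding g_def by (rule inv_f_f)
  have per: "g (t + 2 * pi) = g t + 2 * pi" for t
    by (metis f(3) fg gf)
  have ng: "ndiff n g" for n
    by (rule ndiff_inverse_function[OF f(1,2) gf fg])
  have "deriv g t > 0" for t
  proof -
    have "((\<lambda>t. f (g t)) has_real_derivative deriv f (g t) * deriv g t) (at t)"
      using DERIV_chain2[OF df ndiff_deriv[OF ng]] .
    hence "deriv f (g t) * deriv g t = 1"
      unfolding fg using DERIV_ident DERIV_unique by blast
    thus ?thesis using f(2)[of "g t"] by (metis zero_less_mult_pos zero_less_one)
  qed
  then obtain k where "oriented_circle_diffeo k" "\<And>t. k (cis t) = cis (g t)"
    using oriented_circle_diffeo_of_lift[OF ng _ per] by blast
  moreover from this have "k (h z) = z" if "z \<in> sphere 0 1" for z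
    using that unfolding in_circle_iff by (auto simp: f(4) gf)
  ultimately show ?thesis using that by blast
qed

text \<open>
  For \<open>F = {z\<^sub>1, \<dots>, z\<^sub>k}\<close> take the product of the functions
  \<open>t \<mapsto> \<bar>cis t - z\<^sub>i\<bar>\<^sup>2 / 2 = 1 - Re z\<^sub>i cos t - Im z\<^sub>i sin t\<close>.
\<close>

lemma periodic_function_with_zeros:
  assumes "finite F" "F \<subseteq> sphere 0 1"
  shows "\<exists>\<tau> C. (\<forall>n. ndiff n \<tau>) \<and> (\<forall>t. \<tau> (t + 2 * pi) = \<tau> t) \<and> (\<forall>t. \<tau> t = 0 \<longleftrightarrow> cis t \<in> F)
    \<and> (\<forall>t. \<bar>\<tau> t\<bar> \<le> C \<and> \<bar>deriv \<tau> t\<bar> \<le> C)"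
  using assms
proof (induction rule: finite_induct)
  case empty
  show ?case by (rule exI[of _ "\<lambda>t. 1"], rule exI[of _ 1]) (auto simp: ndiff_const)
next
  case (insert z F)
  then obtain \<tau> C where "(\<forall>n. ndiff n \<tau>) \<and> (\<forall>t. \<tau> (t + 2 * pi) = \<tau> t) \<and> (\<forall>t. \<tau> t = 0 \<longleftrightarrow> cis t \<in> F)
      \<and> (\<forall>t. \<bar>\<tau> t\<bar> \<le> C \<and> \<bar>deriv \<tau> t\<bar> \<le> C)"
    by (meson insert_subset)
  hence t: "\<And>n. ndiff n \<tau>" "\<And>t. \<tau> (t + 2 * pi) = \<tau> t"
    "\<And>t. \<tau> t = 0 \<longleftrightarrow> cis t \<in> F" "\<And>t. \<bar>\<tau> t\<bar> \<le> C" "\<And>t. \<bar>deriv \<tau> t\<bar> \<le> C" by auto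
  define q where "q t = 1 + (- Re z * cos t + - Im z * sin t)" for t
  define q' where "q' t = Re z * sin t - Im z * cos t" for t
  have z: "(Re z)^2 + (Im z)^2 = 1" using insert.prems by (simp add: cmod_def)
  have q0: "q t = 0 \<longleftrightarrow> cis t = z" for t
  proof -
    have "(cos t - Re z)^2 + (sin t - Im z)^2 = 2 * q t"
      using z sin_cos_squared_add[of t] unfolding q_def by (simp add: power2_eq_square algebra_simps)
    hence "q t = 0 \<longleftrightarrow> (cos t - Re z)^2 + (sin t - Im z)^2 = 0" by simp
    thus ?thesis by (simp add: sum_power2_eq_zero_iff complex_eq_iff)
  qed
  have nq: "ndiff n q" for n
    unfolding q_def[abs_def] using ndiff_sin_cos[of n] by (intro ndiff_add ndiff_mult ndiff_const) auto
  have dq: "(q has_real_derivative q' t) (at t)" for t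
    unfolding q_def[abs_def] q'_def by (auto intro!: derivative_eq_intros)
  have le1: "\<bar>Re z\<bar> \<le> 1" "\<bar>Im z\<bar> \<le> 1"
    using insert.prems abs_Re_le_cmod[of z] abs_Im_le_cmod[of z] by auto
  have m: "\<bar>Re z * u\<bar> \<le> 1" "\<bar>Im z * u\<bar> \<le> 1" if "\<bar>u\<bar> \<le> 1" for u
    using le1 that by (auto simp: abs_mult mult_le_one)
  \<comment> \<open>The bound 3 for \<open>q\<close> is 1 plus two terms of absolute value at most
    1.\<close>
  have qb: "\<bar>q t\<bar> \<le> 3" "\<bar>q' t\<bar> \<le> 3" for t
    using m[of "sin t"] m[of "cos t"] by (auto simp: q_def q'_def)
  have C: "C \<ge> 0" using t(4)[of 0] by linarith
  define \<sigma> where "\<sigma> t = q t * \<tau> t" for t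
  have "(\<sigma> has_real_derivative q' t * \<tau> t + deriv \<tau> t * q t) (at t)" for t
    unfolding \<sigma>_def[abs_def] using DERIV_mult[OF dq ndiff_deriv[OF t(1)]] .
  hence d\<sigma>: "deriv \<sigma> t = q' t * \<tau> t + deriv \<tau> t * q t" for t
    by (rule DERIV_imp_deriv)
  show ?case
  proof (intro exI conjI allI)
    show "ndiff n \<sigma>" for n unfolding \<sigma>_def[abs_def] using nq t(1) by (rule ndiff_mult)
    show "\<sigma> (t + 2 * pi) = \<sigma> t" for t by (simp add: \<sigma>_def q_def t(2))
    show "(\<sigma> t = 0) = (cis t \<in> insert z F)" for t by (simp add: \<sigma>_def t(3) q0)
    \<comment> \<open>The derivative of \<open>\<sigma>\<close> is a sum of two such products,
      whence \<open>6 * C\<close>. One of them contains \<open>\<tau>\<close> itself, which is why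
      the induction carries a bound on \<open>\<tau>\<close> besides the one on its
      derivative.\<close>
    have p: "\<bar>x * y\<bar> \<le> 3 * C" if "\<bar>x\<bar> \<le> 3" "\<bar>y\<bar> \<le> C" for x y
      unfolding abs_mult using that by (intro mult_mono) auto
    show "\<bar>\<sigma> t\<bar> \<le> 6 * C" for t using p[OF qb(1)[of t] t(4)[of t]] C by (simp add: \<sigma>_def)
    show "\<bar>deriv \<sigma> t\<bar> \<le> 6 * C" for t
      using p[OF qb(2)[of t] t(4)[of t]] p[OF qb(1)[of t] t(5)[of t]]
      by (simp add: d\<sigma> mult.commute)
  qed
qed

text \<open>
  With \<open>\<tau>\<close> vanishing exactly at \<open>F\<close>, the lift \<open>t \<mapsto> t + \<epsilon> * \<tau> t\<close> is increasing for small
  \<open>\<epsilon>\<close>; so the orbits under the diffeomorphisms fixing \<open>F\<close> pointwise are relatively open, and a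
  connected set avoiding \<open>F\<close> lies in one orbit. No bump functions are needed.
\<close>

lemma move_point:
  assumes F: "finite F" "F \<subseteq> sphere 0 1" and ab: "a \<le> b" "\<And>t. a \<le> t \<Longrightarrow> t \<le> b \<Longrightarrow> cis t \<notin> F"
  shows "\<exists>h. oriented_circle_diffeo h \<and> (\<forall>z\<in>F. h z = z) \<and> h (cis a) = cis b"
proof (rule connected_equivalence_relation[of "{a..b}" a b
      "\<lambda>a b. \<exists>h. oriented_circle_diffeo h \<and> (\<forall>z\<in>F. h z = z) \<and> h (cis a) = cis b"])
  fix x y
  assume "\<exists>h. oriented_circle_diffeo h \<and> (\<forall>z\<in>F. h z = z) \<and> h (cis x) = cis y"
  then obtain h where h: "oriented_circle_diffeo h" "\<forall>z\<in>F. h z = z" "h (cis x) = cis y" by blast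
  obtain k where k: "oriented_circle_diffeo k" "\<And>z. z \<in> sphere 0 1 \<Longrightarrow> k (h z) = z"
    using oriented_circle_diffeo_inverse[OF h(1)] by blast
  have "k z = z" if "z \<in> F" for z using k(2)[of z] h(2) that F(2) by auto
  moreover have "k (cis y) = cis x" using k(2)[of "cis x"] h(3) by simp
  ultimately show "\<exists>h. oriented_circle_diffeo h \<and> (\<forall>z\<in>F. h z = z) \<and> h (cis y) = cis x"
    using k(1) by blast
next
  fix x y z
  assume "\<exists>h. oriented_circle_diffeo h \<and> (\<forall>z\<in>F. h z = z) \<and> h (cis x) = cis y"
  then obtain h where h: "oriented_circle_diffeo h" "\<forall>z\<in>F. h z = z" "h (cis x) = cis y" by blast
  assume "\<exists>h. oriented_circle_diffeo h \<and> (\<forall>z\<in>F. h z = z) \<and> h (cis y) = cis z"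
  then obtain k where k: "oriented_circle_diffeo k" "\<forall>z\<in>F. k z = z" "k (cis y) = cis z" by blast
  show "\<exists>h. oriented_circle_diffeo h \<and> (\<forall>z\<in>F. h z = z) \<and> h (cis x) = cis z"
    using h k by (intro exI[of _ "k \<circ> h"]) (simp add: oriented_circle_diffeo_comp)
next
  fix x assume x: "x \<in> {a..b}"
  obtain \<tau> C where t: "\<And>n. ndiff n \<tau>" "\<And>t. \<tau> (t + 2 * pi) = \<tau> t"
    "\<And>t. \<tau> t = 0 \<longleftrightarrow> cis t \<in> F" "\<And>t. \<bar>deriv \<tau> t\<bar> \<le> C"
    using periodic_function_with_zeros[OF F] by blast
  have \<tau>x: "\<tau> x \<noteq> 0" using x ab t(3) by auto
  have C: "C \<ge> 0" using t(4)[of 0] by linarith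
  \<comment> \<open>For \<open>\<bar>y - x\<bar> < d\<close> the factor \<open>\<epsilon>\<close>
    chosen below satisfies \<open>\<bar>\<epsilon>\<bar> * (C + 1) < 1\<close>, which keeps the
    derivative of the lift positive. Adding 1 to \<open>C\<close> avoids division by zero.\<close>
  define d where "d = \<bar>\<tau> x\<bar> / (C + 1)"
  have d: "d > 0" using \<tau>x C by (simp add: d_def)
  have "\<exists>h. oriented_circle_diffeo h \<and> (\<forall>z\<in>F. h z = z) \<and> h (cis x) = cis y" if y: "\<bar>y - x\<bar> < d" for y
  proof -
    \<comment> \<open>Solves \<open>x + \<epsilon> * \<tau> x = y\<close>.\<close>
    define \<epsilon> where "\<epsilon> = (y - x) / \<tau> x"
    define f where "f t = t + \<epsilon> * \<tau> t" for t
    have "\<bar>\<epsilon>\<bar> < d / \<bar>\<tau> x\<bar>" using y \<tau>x unfolding \<epsilon>_def abs_divide by (intro divide_strict_right_mono) auto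
    also have "\<dots> = 1 / (C + 1)" using \<tau>x by (simp add: d_def)
    finally have "\<bar>\<epsilon>\<bar> * (C + 1) < 1" using C by (simp add: less_divide_eq)
    moreover have "\<bar>\<epsilon> * deriv \<tau> t\<bar> \<le> \<bar>\<epsilon>\<bar> * (C + 1)" for t
      unfolding abs_mult using t(4)[of t] by (intro mult_left_mono) auto
    ultimately have small: "\<bar>\<epsilon> * deriv \<tau> t\<bar> < 1" for t by (meson le_less_trans)
    have "(f has_real_derivative 1 + \<epsilon> * deriv \<tau> t) (at t)" for t
      unfolding f_def[abs_def]
      by (intro DERIV_add DERIV_ident DERIV_cmult ndiff_deriv[OF t(1)])
    hence "deriv f t = 1 + \<epsilon> * deriv \<tau> t" for t by (rule DERIV_imp_deriv)
    hence "deriv f t > 0" for t using small[of t] by (simp add: abs_less_iff)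
    moreover have "ndiff n f" for n
      unfolding f_def[abs_def] by (intro ndiff_add ndiff_id ndiff_mult ndiff_const t(1))
    moreover have "f (t + 2 * pi) = f t + 2 * pi" for t by (simp add: f_def t(2))
    ultimately obtain h where h: "oriented_circle_diffeo h" "\<And>t. h (cis t) = cis (f t)"
      using oriented_circle_diffeo_of_lift by blast
    have "h z = z" if "z \<in> F" for z
    proof -
      have "z \<in> sphere 0 1" using that F(2) by blast
      then obtain s where s: "z = cis s" unfolding in_circle_iff by blast
      hence "\<tau> s = 0" using that t(3) by simp
      thus ?thesis by (simp add: s h(2) f_def)
    qed
    moreover have "f x = y" using \<tau>x by (simp add: f_def \<epsilon>_def)
    ultimately show ?thesis using h by blast
  qed
  moreover have "openin (top_of_set {a..b}) ({a..b} \<inter> ball x d)"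
    by (rule openin_open_Int) simp
  ultimately show "\<exists>T. openin (top_of_set {a..b}) T \<and> x \<in> T \<and>
      (\<forall>y\<in>T. \<exists>h. oriented_circle_diffeo h \<and> (\<forall>z\<in>F. h z = z) \<and> h (cis x) = cis y)"
    using x d by (intro exI[of _ "{a..b} \<inter> ball x d"]) (auto simp: dist_real_def abs_minus_commute)
qed (use ab in auto)

section \<open>Chord diagrams and arcs\<close>

lemma oriented_circle_diffeo_id: "oriented_circle_diffeo id"
  unfolding oriented_circle_diffeo_def
  by (rule exI[of _ "\<lambda>t. t"]) (auto simp: smooth_real_iff_ndiff ndiff_id)

lemma diagram_self: "X \<in> diagram X"
  unfolding diagram_def
  by (rule CollectI, rule exI[of _ id]) (simp add: oriented_circle_diffeo_id map_prod.id)

lemma chord_image_cong: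
  assumes "\<And>z. z \<in> endpoints X \<Longrightarrow> h z = k z"
  shows "map_prod (image h) id ` X = map_prod (image k) id ` X"
proof (rule image_cong[OF refl])
  fix c assume "c \<in> X"
  hence "h ` fst c = k ` fst c" using assms by (intro image_cong) (auto simp: endpoints_def)
  thus "map_prod (image h) id c = map_prod (image k) id c" by (simp add: map_prod_def case_prod_beta)
qed

lemma chord_image_comp:
  "map_prod (image h) id ` map_prod (image k) id ` X = map_prod (image (h \<circ> k)) id ` X"
  unfolding image_image by (rule image_cong) (auto simp: map_prod_def case_prod_beta image_image)

lemma chord_image_id:
  assumes "\<And>z. z \<in> endpoints X \<Longrightarrow> h z = z"
  shows "map_prod (image h) id ` X = X"
  using chord_image_cong[of X h id] assms by (simp add: map_prod.id)

text \<open>The diffeomorphisms are closed under composition, and \<open>h\<close> has an inverse,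
  but one that undoes \<open>h\<close> only on the circle; hence the hypothesis on the
  endpoints.\<close>

lemma diagram_chord_image:
  assumes h: "oriented_circle_diffeo h" and X: "endpoints X \<subseteq> sphere 0 1"
  shows "diagram (map_prod (image h) id ` X) = diagram X"
proof (rule equalityI; rule subsetI)
  fix Y assume "Y \<in> diagram (map_prod (image h) id ` X)"
  then obtain g where "oriented_circle_diffeo g" "Y = map_prod (image (g \<circ> h)) id ` X"
    by (auto simp: diagram_def chord_image_comp)
  thus "Y \<in> diagram X" using oriented_circle_diffeo_comp[OF _ h] unfolding diagram_def by blast
next
  fix Y assume "Y \<in> diagram X"
  then obtain g where g: "oriented_circle_diffeo g" "Y = map_prod (image g) id ` X"
    by (auto simp: diagram_def)
  obtain k where k: "oriented_circle_diffeo k" "\<And>z. z \<in> sphere 0 1 \<Longrightarrow> k (h z) = z"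
    using oriented_circle_diffeo_inverse[OF h] by blast
  have "Y = map_prod (image (g \<circ> k \<circ> h)) id ` X"
    unfolding g(2) by (rule chord_image_cong) (use k(2) X in auto)
  hence "Y = map_prod (image (g \<circ> k)) id ` map_prod (image h) id ` X"
    by (simp only: chord_image_comp)
  thus "Y \<in> diagram (map_prod (image h) id ` X)"
    using oriented_circle_diffeo_comp[OF g(1) k(1)] unfolding diagram_def by blast
qed

text \<open>Makes subsets of \<open>X\<close> correspond bijectively to subsets of its image, as is
  needed to reindex the sum over splittings.\<close>

lemma chord_image_inj:
  assumes h: "oriented_circle_diffeo h" and X: "endpoints X \<subseteq> sphere 0 1"
  shows "inj_on (map_prod (image h) id) X"
proof -
  obtain k where k: "oriented_circle_diffeo k" "\<And>z. z \<in> sphere 0 1 \<Longrightarrow> k (h z) = z"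
    using oriented_circle_diffeo_inverse[OF h] by blast
  show ?thesis
  proof (rule inj_on_inverseI[of _ "map_prod (image k) id"])
    fix c assume "c \<in> X"
    hence "fst c \<subseteq> sphere 0 1" using X by (auto simp: endpoints_def)
    hence "(\<lambda>z. k (h z)) ` fst c = fst c" using k(2) by (force simp: image_iff)
    thus "map_prod (image k) id (map_prod (image h) id c) = c"
      by (simp add: map_prod_def case_prod_beta image_image)
  qed
qed

lemma endpoints_insert: "endpoints (insert (c, \<phi>) X) = c \<union> endpoints X"
  by (auto simp: endpoints_def)

lemma endpoints_mono: "S \<subseteq> X \<Longrightarrow> endpoints S \<subseteq> endpoints X"
  by (auto simp: endpoints_def)

lemma chord_collectionD:
  assumes "chord_collection X"
  shows "finite X" and "(c, \<phi>) \<in> X \<Longrightarrow> c \<subseteq> sphere 0 1 \<and> card c = 2"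
    and "a \<in> X \<Longrightarrow> b \<in> X \<Longrightarrow> a \<noteq> b \<Longrightarrow> fst a \<inter> fst b = {}"
  using assms unfolding chord_collection_def by (blast, fast, blast)

lemma chord_collection_subset:
  assumes "chord_collection X" "S \<subseteq> X"
  shows "chord_collection S"
  using assms(1) finite_subset[OF assms(2)] subsetD[OF assms(2)]
  unfolding chord_collection_def case_prod_beta by simp

lemma endpoints_in_circle:
  assumes "chord_collection X"
  shows "endpoints X \<subseteq> sphere 0 1"
proof
  fix z assume "z \<in> endpoints X"
  then obtain c \<phi> where "(c, \<phi>) \<in> X" "z \<in> c" by (auto simp: endpoints_def)
  thus "z \<in> sphere 0 1" using chord_collectionD(2)[OF assms] by blast
qed

lemma finite_endpoints:
  assumes "chord_collection X"
  shows "finite (endpoints X)"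
proof -
  have "finite (fst c)" if "c \<in> X" for c
    using chord_collectionD(2)[OF assms, of "fst c" "snd c"] that by (intro card_ge_0_finite) simp
  thus ?thesis unfolding endpoints_def using chord_collectionD(1)[OF assms] by blast
qed

lemma chord_collection_insert:
  assumes "chord_collection X" "r \<in> sphere 0 1 - endpoints X" "x \<in> sphere 0 1 - endpoints X" "r \<noteq> x"
  shows "chord_collection (insert ({r, x}, \<phi>) X)"
proof -
  have "finite X" "\<forall>(c, \<phi>)\<in>X. c \<subseteq> sphere 0 1 \<and> card c = 2"
    and disj: "\<And>a b. a \<in> X \<Longrightarrow> b \<in> X \<Longrightarrow> a \<noteq> b \<Longrightarrow> fst a \<inter> fst b = {}"
    using assms(1) unfolding chord_collection_def by blast+
  moreover have new: "fst a \<inter> {r, x} = {}" if "a \<in> X" for a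
    using assms(2,3) that unfolding endpoints_def by blast
  moreover have "fst a \<inter> fst b = {}"
    if "a \<in> insert ({r, x}, \<phi>) X" "b \<in> insert ({r, x}, \<phi>) X" "a \<noteq> b" for a b
    using that disj[of a b] new[of a] new[of b] by (auto simp del: insert_disjoint disjoint_insert)
  ultimately show ?thesis
    using assms(2-4) unfolding chord_collection_def by (simp add: case_prod_beta)
qed

lemma diagram_in_framed: "chord_collection X \<Longrightarrow> diagram X \<in> framed_chord_diagrams"
  by (auto simp: framed_chord_diagrams_def)

text \<open>Diffeomorphisms leave framings alone, so one all-oriented representative forces every
  representative of the orbit to be all-oriented.\<close>

lemma diagram_in_black_iff:
  assumes "chord_collection X"
  shows "diagram X \<in> black_chord_diagrams \<longleftrightarrow> all_oriented X"
proof
  assume "diagram X \<in> black_chord_diagrams"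
  then obtain Y where Y: "diagram X = diagram Y" "all_oriented Y"
    by (auto simp: black_chord_diagrams_def)
  have "X \<in> diagram Y" using diagram_self[of X] by (simp add: Y(1))
  thus "all_oriented X" using Y(2) by (auto simp: diagram_def all_oriented_def)
qed (use assms in \<open>auto simp: black_chord_diagrams_def\<close>)

section \<open>Sliding the end of a chord along an arc\<close>

lemma circle_arc:
  assumes "x \<in> sphere 0 1" "y \<in> sphere 0 1" "x \<noteq> y"
  obtains a b where "a < b" "cis a = x" "cis b = y" "\<And>t. a < t \<Longrightarrow> t < b \<Longrightarrow> cis t \<in> open_arc x y"
proof -
  obtain a where a: "cis a = x" using assms(1) unfolding in_circle_iff by blast
  obtain b0 where b0: "cis b0 = y" using assms(2) unfolding in_circle_iff by blast
  \<comment> \<open>The shift by \<open>n\<close> turns brings \<open>b0\<close> into the half-open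
    period starting at \<open>a\<close>; \<open>x \<noteq> y\<close> then excludes \<open>a\<close>
    itself.\<close>
  define n where "n = \<lfloor>(b0 - a) / (2 * pi)\<rfloor>"
  define b where "b = b0 + 2 * pi * of_int (- n)"
  have b: "cis b = y" unfolding b0[symmetric] cis_eq_iff b_def by blast
  have "of_int n \<le> (b0 - a) / (2 * pi)" "(b0 - a) / (2 * pi) < of_int n + 1"
    unfolding n_def by linarith+
  hence "of_int n * (2 * pi) \<le> b0 - a" "b0 - a < (of_int n + 1) * (2 * pi)"
    by (simp_all only: pos_le_divide_eq pos_divide_less_eq pi_gt_zero zero_less_mult_iff
        zero_less_numeral simp_thms)
  hence "a \<le> b" "b < a + 2 * pi" by (simp_all add: b_def algebra_simps)
  moreover from this have "a < b" using a b assms(3) by (metis order_le_less)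
  ultimately show ?thesis using a b by (intro that[of a b]) (auto simp: open_arc_def)
qed

text \<open>Lifts of the arcs from \<open>x\<close> to \<open>p\<close> and from \<open>p\<close> to
  \<open>y\<close> are glued at \<open>p\<close> into one interval, along which \<open>p\<close> is
  the only point of \<open>P\<close> met. Leaving \<open>p\<close> out of \<open>F\<close> thus
  removes the only obstruction.\<close>

lemma neighbours_arc:
  assumes "immediately_before P p x" "immediately_after P p y" "p \<in> P" "p \<in> sphere 0 1"
    and F: "F \<subseteq> P - {p}"
  obtains a c where "a \<le> c" "cis a = x" "cis c = y" "\<And>t. a \<le> t \<Longrightarrow> t \<le> c \<Longrightarrow> cis t \<notin> F"
proof -
  have x: "x \<in> sphere 0 1" "x \<notin> P" "open_arc x p \<inter> P = {}"
    using assms(1) by (auto simp: immediately_before_def)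
  have y: "y \<in> sphere 0 1" "y \<notin> P" "open_arc p y \<inter> P = {}"
    using assms(2) by (auto simp: immediately_after_def)
  obtain a b where ab: "a < b" "cis a = x" "cis b = p" "\<And>t. a < t \<Longrightarrow> t < b \<Longrightarrow> cis t \<in> open_arc x p"
    using circle_arc[of x p] x assms(3,4) by blast
  obtain b' c where bc: "b' < c" "cis b' = p" "cis c = y"
    "\<And>t. b' < t \<Longrightarrow> t < c \<Longrightarrow> cis t \<in> open_arc p y"
    using circle_arc[of p y] y assms(3,4) by blast
  obtain n where n: "b' = b + 2 * pi * of_int n"
    using ab(3) bc(2) cis_eq_iff[of b' b] by auto
  \<comment> \<open>The two lifts of \<open>p\<close> may differ by full turns; \<open>s\<close>
    realigns the second interval so that it starts where the first one ends.\<close>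
  define s where "s = 2 * pi * of_int n"
  have sh: "cis (t + s) = cis t" for t unfolding cis_eq_iff s_def by blast
  show ?thesis
  proof (rule that[of a "c - s"])
    show "a \<le> c - s" using ab(1) bc(1) n by (simp add: s_def)
    show "cis (c - s) = y" using sh[of "c - s"] bc(3) by simp
    fix t assume t: "a \<le> t" "t \<le> c - s"
    consider "t = a" | "a < t" "t < b" | "t = b" | "b < t" "t < c - s" | "t = c - s"
      using t by linarith
    thus "cis t \<notin> F"
    proof cases
      case 4
      hence "cis (t + s) \<in> open_arc p y" using n by (intro bc(4)) (auto simp: s_def)
      thus ?thesis using y(3) F by (auto simp: sh)
    next
      case 5
      thus ?thesis using sh[of t] bc(3) y(2) F by auto
    qed (use ab x F in auto)
  qed (rule ab)
qed

text \<open>A diffeomorphism that fixes \<open>r\<close> and the ends of \<open>S\<close> and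
  carries \<open>x\<close> to \<open>y\<close> maps one collection onto the other. \<open>P\<close>
  may contain more points than these, so neighbours taken in a larger collection can be used for a
  part \<open>S\<close>.\<close>

lemma with_jumping_chord_eq:
  assumes S: "chord_collection S" and r: "r \<in> sphere 0 1"
    and "immediately_before P p x" "immediately_after P p y" "p \<in> P" "p \<in> sphere 0 1"
    and F: "insert r (endpoints S) \<subseteq> P - {p}"
  shows "with_jumping_chord S r \<phi> x = with_jumping_chord S r \<phi> y"
proof -
  obtain a c where ac: "a \<le> c" "cis a = x" "cis c = y"
    "\<And>t. a \<le> t \<Longrightarrow> t \<le> c \<Longrightarrow> cis t \<notin> insert r (endpoints S)"
    using neighbours_arc[OF assms(3-7)] by blast
  have "finite (insert r (endpoints S))" "insert r (endpoints S) \<subseteq> sphere 0 1"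
    using finite_endpoints[OF S] endpoints_in_circle[OF S] r by auto
  from move_point[OF this ac(1,4)] obtain h where h: "oriented_circle_diffeo h"
    "\<And>z. z \<in> insert r (endpoints S) \<Longrightarrow> h z = z" "h x = y"
    unfolding ac(2,3) by blast
  have "map_prod (image h) id ` S = S" using h(2) by (intro chord_image_id) auto
  hence "map_prod (image h) id ` insert ({r, x}, \<phi>) S = insert ({r, y}, \<phi>) S"
    using h(2,3) by simp
  moreover have "x \<in> sphere 0 1" using assms(3) by (simp add: immediately_before_def)
  hence "endpoints (insert ({r, x}, \<phi>) S) \<subseteq> sphere 0 1"
    using endpoints_in_circle[OF S] r by (auto simp: endpoints_insert)
  ultimately show ?thesis
    using diagram_chord_image[OF h(1)] by (metis with_jumping_chord_def)
qed

section \<open>Restricting four-term data to a part of the collection\<close>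

text \<open>Removing chords only removes marked points, so arcs free of marked points remain free;
  \<open>v\<close> has to stay in order to provide \<open>p\<close> and \<open>q\<close>.\<close>

lemma four_term_data_subset:
  assumes "four_term_data X \<psi> p q r pm pp qm qp" "S \<subseteq> X" "({p, q}, \<psi>) \<in> S"
  shows "four_term_data S \<psi> p q r pm pp qm qp"
  using assms endpoints_mono[OF assms(2)] chord_collection_subset[OF _ assms(2)]
  unfolding four_term_data_def Let_def immediately_before_def immediately_after_def by blast

lemma four_term_data_chord_collection:
  assumes "four_term_data X \<psi> p q r pm pp qm qp" "x \<in> {pm, pp, qm, qp}"
  shows "chord_collection (insert ({r, x}, \<phi>) X)"
proof (rule chord_collection_insert)
  show "x \<in> sphere 0 1 - endpoints X" "r \<noteq> x"
    using assms by (auto simp: four_term_data_def Let_def immediately_before_def immediately_after_def)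
qed (use assms in \<open>auto simp: four_term_data_def Let_def\<close>)

text \<open>Chords are pairwise disjoint, so without \<open>v\<close> no chord of \<open>S\<close>
  ends at \<open>p\<close> or \<open>q\<close>, and \<open>r\<close> is neither of them. Both points
  can therefore be passed.\<close>

lemma four_term_data_without_chord:
  assumes d: "four_term_data X \<psi> p q r pm pp qm qp" and S: "S \<subseteq> X" "({p, q}, \<psi>) \<notin> S"
  shows "with_jumping_chord S r \<phi> pm = with_jumping_chord S r \<phi> pp"
    and "with_jumping_chord S r \<phi> qm = with_jumping_chord S r \<phi> qp"
proof -
  define P where "P = insert r (endpoints X)"
  have X: "chord_collection X" "({p, q}, \<psi>) \<in> X" "r \<in> sphere 0 1" "r \<notin> endpoints X"
    and nb: "immediately_before P p pm" "immediately_after P p pp"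
    "immediately_before P q qm" "immediately_after P q qp"
    using d by (auto simp: four_term_data_def Let_def P_def)
  have pq: "p \<in> endpoints X" "q \<in> endpoints X" using X(2) by (force simp: endpoints_def)+
  hence pqs: "p \<in> sphere 0 1" "q \<in> sphere 0 1" "p \<noteq> r" "q \<noteq> r" "p \<in> P" "q \<in> P"
    using endpoints_in_circle[OF X(1)] X(4) by (auto simp: P_def)
  have "fst c \<inter> {p, q} = {}" if "c \<in> S" for c
    using chord_collectionD(3)[OF X(1) subsetD[OF S(1) that] X(2)] S(2) that by auto
  hence "p \<notin> endpoints S" "q \<notin> endpoints S" by (auto simp: endpoints_def)
  hence "insert r (endpoints S) \<subseteq> P - {p}" "insert r (endpoints S) \<subseteq> P - {q}"
    using endpoints_mono[OF S(1)] pqs by (auto simp: P_def)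
  with with_jumping_chord_eq[OF chord_collection_subset[OF X(1) S(1)] X(3)] nb pqs
  show "with_jumping_chord S r \<phi> pm = with_jumping_chord S r \<phi> pp"
    and "with_jumping_chord S r \<phi> qm = with_jumping_chord S r \<phi> qp" by blast+
qed

section \<open>Relations, projection and comultiplication\<close>

text \<open>Leads to the subtraction-free form \<open>a + d = b + c\<close>, which can be summed
  over splittings term by term and is evident when \<open>a = b\<close> and
  \<open>c = d\<close>.\<close>

lemma (in abelian_group) four_term_rearrange:
  assumes "a \<in> carrier G" "b \<in> carrier G" "c \<in> carrier G" "d \<in> carrier G"
  shows "(a \<ominus> b) \<ominus> (c \<ominus> d) = (a \<oplus> d) \<ominus> (b \<oplus> c)"
  using assms by (simp add: a_minus_def minus_add a_ac)

lemma linear_extension_four_term: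
  assumes W: "module K W" and g: "g \<in> X \<rightarrow> carrier W" and abcd: "a \<in> X" "b \<in> X" "c \<in> X" "d \<in> X"
  defines "F \<equiv> free_module K X" and "e \<equiv> basis_vector K"
  shows "linear_extension K W g ((e a \<ominus>\<^bsub>F\<^esub> e b) \<ominus>\<^bsub>F\<^esub> (e c \<ominus>\<^bsub>F\<^esub> e d)) = \<zero>\<^bsub>W\<^esub>
    \<longleftrightarrow> g a \<oplus>\<^bsub>W\<^esub> g d = g b \<oplus>\<^bsub>W\<^esub> g c"
proof -
  interpret W: module K W by fact
  have F: "module K F" unfolding F_def by (rule free_module_is_module) unfold_locales
  interpret F: module K F by fact
  have e: "e x \<in> carrier F" if "x \<in> X" for x
    unfolding e_def F_def by (rule basis_vector_closed[OF W.R.cring_axioms that])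
  have gc: "g x \<in> carrier W" if "x \<in> X" for x using g that by blast
  have le: "linear_extension K W g (e x) = g x" if "x \<in> X" for x
    unfolding e_def by (rule linear_extension_basis_vector[OF W g that])
  have L: "linear_extension K W g \<in> linear_maps K F W"
    unfolding F_def by (rule linear_extension_linear[OF W g])
  show ?thesis
    using abcd by (simp add: linear_maps_minus[OF F W L] e le gc W.four_term_rearrange
        W.minus_eq_zero_iff)
qed

lemma generated_quotient_four_term:
  assumes K: "cring K" and abcd: "a \<in> X" "b \<in> X" "c \<in> X" "d \<in> X"
  defines "F \<equiv> free_module K X" and "e \<equiv> basis_vector K"
  assumes R: "R \<subseteq> carrier F" "(e a \<ominus>\<^bsub>F\<^esub> e b) \<ominus>\<^bsub>F\<^esub> (e c \<ominus>\<^bsub>F\<^esub> e d) \<in> R"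
  defines "H \<equiv> generated_submodule K F R"
  shows "(H +>\<^bsub>F\<^esub> e a) \<oplus>\<^bsub>quotient_module F H\<^esub> (H +>\<^bsub>F\<^esub> e d)
    = (H +>\<^bsub>F\<^esub> e b) \<oplus>\<^bsub>quotient_module F H\<^esub> (H +>\<^bsub>F\<^esub> e c)"
proof -
  interpret F: module K F unfolding F_def by (rule free_module_is_module[OF K])
  have e: "e x \<in> carrier F" if "x \<in> X" for x
    unfolding e_def F_def by (rule basis_vector_closed[OF K that])
  have H: "submodule H K F" unfolding H_def by (rule F.generated_submodule_is_submodule[OF R(1)])
  have "(e a \<ominus>\<^bsub>F\<^esub> e b) \<ominus>\<^bsub>F\<^esub> (e c \<ominus>\<^bsub>F\<^esub> e d) \<in> H"
    unfolding H_def by (rule subsetD[OF generated_submodule_incl R(2)])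
  hence "(e a \<oplus>\<^bsub>F\<^esub> e d) \<ominus>\<^bsub>F\<^esub> (e b \<oplus>\<^bsub>F\<^esub> e c) \<in> H"
    using abcd by (simp add: F.four_term_rearrange e)
  thus ?thesis using abcd by (simp add: F.quotient_add[OF H] F.quotient_coset_eq_iff[OF H] e)
qed

text \<open>
  Both kinds of relations have this shape; for an oriented distinguished chord \<open>c = q\<^sup>+\<close>,
  \<open>d = q\<^sup>-\<close> and \<open>\<phi>' = \<phi>\<close>, for a disorienting one \<open>c = q\<^sup>-\<close>, \<open>d = q\<^sup>+\<close> and \<open>\<phi>' = \<phi> + 1\<close>.
\<close>

definition four_terms ::
    "('k, 'r) ring_scheme \<Rightarrow> framed_chord set \<Rightarrow> complex \<Rightarrow> bit \<Rightarrow> bit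
      \<Rightarrow> complex \<Rightarrow> complex \<Rightarrow> complex \<Rightarrow> complex \<Rightarrow> framed_chord_diagram \<Rightarrow> 'k" where
  "four_terms K X r \<phi> \<phi>' a b c d =
     (let F = free_module K framed_chord_diagrams;
          D = (\<lambda>\<phi> x. basis_vector K (with_jumping_chord X r \<phi> x)) in
       (D \<phi> a \<ominus>\<^bsub>F\<^esub> D \<phi> b) \<ominus>\<^bsub>F\<^esub> (D \<phi>' c \<ominus>\<^bsub>F\<^esub> D \<phi>' d))"

lemma framed_4T_relations_alt:
  "framed_4T_relations K =
     {four_terms K X r \<phi> \<phi> pm pp qp qm | X p q r pm pp qm qp \<phi>.
        four_term_data X 0 p q r pm pp qm qp} \<union>
     {four_terms K X r \<phi> (\<phi> + 1) pm pp qm qp | X p q r pm pp qm qp \<phi>.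
        four_term_data X 1 p q r pm pp qm qp}"
  unfolding framed_4T_relations_def four_terms_def Let_def ..

text \<open>Reduces both kinds of relations to one alternative for every part \<open>S\<close>: a
  relation of the same shape holds for it, or its terms agree in pairs. From here on the
  comultiplication needs neither \<open>p\<close> and \<open>q\<close> nor the framing of
  \<open>v\<close>.\<close>

lemma framed_4T_relationE:
  assumes "\<rho> \<in> framed_4T_relations K"
  obtains X r \<phi> \<phi>' a b c d where "\<rho> = four_terms K X r \<phi> \<phi>' a b c d"
    and "chord_collection X" and "r \<notin> endpoints X"
    and "\<And>x \<theta>. x \<in> {a, b, c, d} \<Longrightarrow> chord_collection (insert ({r, x}, \<theta>) X)"
    and "\<And>S. S \<subseteq> X \<Longrightarrow> four_terms K S r \<phi> \<phi>' a b c d \<in> framed_4T_relations K \<or>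
      with_jumping_chord S r \<phi> a = with_jumping_chord S r \<phi> b \<and>
      with_jumping_chord S r \<phi>' c = with_jumping_chord S r \<phi>' d"
proof -
  from assms consider
    (oriented) X p q r pm pp qm qp \<phi> where "\<rho> = four_terms K X r \<phi> \<phi> pm pp qp qm"
      "four_term_data X 0 p q r pm pp qm qp"
  | (disorienting) X p q r pm pp qm qp \<phi> where "\<rho> = four_terms K X r \<phi> (\<phi> + 1) pm pp qm qp"
      "four_term_data X 1 p q r pm pp qm qp"
    unfolding framed_4T_relations_alt by blast
  thus ?thesis
  proof cases
    case oriented
    show ?thesis
    proof (rule that[OF oriented(1)])
      show "chord_collection X" "r \<notin> endpoints X"
        using oriented(2) by (auto simp: four_term_data_def)
      show "chord_collection (insert ({r, x}, \<theta>) X)" if "x \<in> {pm, pp, qp, qm}" for x \<theta>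
        using four_term_data_chord_collection[OF oriented(2)] that by blast
      show "four_terms K S r \<phi> \<phi> pm pp qp qm \<in> framed_4T_relations K \<or>
          with_jumping_chord S r \<phi> pm = with_jumping_chord S r \<phi> pp \<and>
          with_jumping_chord S r \<phi> qp = with_jumping_chord S r \<phi> qm" if S: "S \<subseteq> X" for S
      proof (cases "({p, q}, 0) \<in> S")
        case True
        from four_term_data_subset[OF oriented(2) S True] show ?thesis
          unfolding framed_4T_relations_alt by blast
      next
        case False
        from four_term_data_without_chord[OF oriented(2) S False] show ?thesis by simp
      qed
    qed
  next
    case disorienting
    show ?thesis
    proof (rule that[OF disorienting(1)])
      show "chord_collection X" "r \<notin> endpoints X"
        using disorienting(2) by (auto simp: four_term_data_def)
      show "chord_collection (insert ({r, x}, \<theta>) X)" if "x \<in> {pm, pp, qm, qp}" for x \<theta>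
        using four_term_data_chord_collection[OF disorienting(2)] that by blast
      show "four_terms K S r \<phi> (\<phi> + 1) pm pp qm qp \<in> framed_4T_relations K \<or>
          with_jumping_chord S r \<phi> pm = with_jumping_chord S r \<phi> pp \<and>
          with_jumping_chord S r (\<phi> + 1) qm = with_jumping_chord S r (\<phi> + 1) qp" if S: "S \<subseteq> X" for S
      proof (cases "({p, q}, 1) \<in> S")
        case True
        from four_term_data_subset[OF disorienting(2) S True] show ?thesis
          unfolding framed_4T_relations_alt by blast
      next
        case False
        from four_term_data_without_chord[OF disorienting(2) S False] show ?thesis by simp
      qed
    qed
  qed
qed

lemma four_terms_closed:
  assumes K: "cring K" and "\<And>x \<theta>. x \<in> {a, b, c, d} \<Longrightarrow> chord_collection (insert ({r, x}, \<theta>) X)"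
  shows "four_terms K X r \<phi> \<phi>' a b c d \<in> carrier (free_module K framed_chord_diagrams)"
proof -
  interpret F: module K "free_module K framed_chord_diagrams" by (rule free_module_is_module[OF K])
  have "basis_vector K (with_jumping_chord X r \<theta> x) \<in> carrier (free_module K framed_chord_diagrams)"
    if "x \<in> {a, b, c, d}" for x \<theta>
    unfolding with_jumping_chord_def
    by (intro basis_vector_closed K diagram_in_framed assms(2) that)
  thus ?thesis unfolding four_terms_def Let_def by simp
qed

lemma framed_4T_relations_closed:
  assumes "cring K"
  shows "framed_4T_relations K \<subseteq> carrier (free_module K framed_chord_diagrams)"
proof
  fix \<rho> assume "\<rho> \<in> framed_4T_relations K"
  thus "\<rho> \<in> carrier (free_module K framed_chord_diagrams)"
  proof (rule framed_4T_relationE)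
    fix X r \<phi> \<phi>' a b c d
    assume "\<rho> = four_terms K X r \<phi> \<phi>' a b c d"
      "\<And>x \<theta>. x \<in> {a, b, c, d} \<Longrightarrow> chord_collection (insert ({r, x}, \<theta>) X)"
    thus ?thesis using four_terms_closed[OF assms] by simp
  qed
qed

lemma ordinary_4T_relations_closed:
  assumes K: "cring K"
  shows "ordinary_4T_relations K \<subseteq> carrier (free_module K black_chord_diagrams)"
proof -
  interpret F: module K "free_module K black_chord_diagrams" by (rule free_module_is_module[OF K])
  have "basis_vector K (with_jumping_chord X r 0 x) \<in> carrier (free_module K black_chord_diagrams)"
    if "all_oriented X" "four_term_data X 0 p q r pm pp qm qp" "x \<in> {pm, pp, qm, qp}"
    for X p q r pm pp qm qp x
  proof -
    have "with_jumping_chord X r 0 x \<in> black_chord_diagrams"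
      unfolding with_jumping_chord_def
      using diagram_in_black_iff[OF four_term_data_chord_collection[OF that(2,3)]] that(1)
      by (simp add: all_oriented_def)
    thus ?thesis by (rule basis_vector_closed[OF K])
  qed
  thus ?thesis unfolding ordinary_4T_relations_def Let_def by auto
qed

section \<open>The spaces of framed and of ordinary diagrams, and their classes\<close>

lemma module_framed_space:
  assumes "cring K" shows "module K (framed_space K)"
  unfolding framed_space_def framed_4T_span_def
  by (intro module.module_quotient module.generated_submodule_is_submodule free_module_is_module
      framed_4T_relations_closed assms)

lemma module_ordinary_space:
  assumes "cring K" shows "module K (ordinary_space K)"
  unfolding ordinary_space_def ordinary_4T_span_def
  by (intro module.module_quotient module.generated_submodule_is_submodule free_module_is_module
      ordinary_4T_relations_closed assms)

lemma framed_class_closed: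
  assumes K: "cring K" and d: "d \<in> framed_chord_diagrams"
  shows "framed_class K d \<in> carrier (framed_space K)"
proof -
  interpret F: module K "free_module K framed_chord_diagrams" by (rule free_module_is_module[OF K])
  show ?thesis unfolding framed_space_def framed_class_def F.quotient_carrier
    by (intro imageI basis_vector_closed K d)
qed

lemma ordinary_class_closed:
  assumes K: "cring K" and d: "d \<in> black_chord_diagrams"
  shows "ordinary_class K d \<in> carrier (ordinary_space K)"
proof -
  interpret F: module K "free_module K black_chord_diagrams" by (rule free_module_is_module[OF K])
  show ?thesis unfolding ordinary_space_def ordinary_class_def F.quotient_carrier
    by (intro imageI basis_vector_closed K d)
qed

lemma framed_class_four_term:
  assumes K: "cring K" and "four_terms K X r \<phi> \<phi>' a b c d \<in> framed_4T_relations K"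
    and "\<And>x \<theta>. x \<in> {a, b, c, d} \<Longrightarrow> chord_collection (insert ({r, x}, \<theta>) X)"
  shows "framed_class K (with_jumping_chord X r \<phi> a) \<oplus>\<^bsub>framed_space K\<^esub>
      framed_class K (with_jumping_chord X r \<phi>' d) =
    framed_class K (with_jumping_chord X r \<phi> b) \<oplus>\<^bsub>framed_space K\<^esub>
      framed_class K (with_jumping_chord X r \<phi>' c)"
proof -
  have D: "with_jumping_chord X r \<theta> x \<in> framed_chord_diagrams" if "x \<in> {a, b, c, d}" for x \<theta>
    unfolding with_jumping_chord_def by (intro diagram_in_framed assms(3) that)
  show ?thesis
    unfolding framed_space_def framed_class_def framed_4T_span_def
    by (rule generated_quotient_four_term[OF K D D D D framed_4T_relations_closed[OF K]
          assms(2)[unfolded four_terms_def Let_def]]) simp_all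
qed

lemma ordinary_class_four_term:
  assumes K: "cring K" and X: "all_oriented X" and d: "four_term_data X 0 p q r pm pp qm qp"
  shows "ordinary_class K (with_jumping_chord X r 0 pm) \<oplus>\<^bsub>ordinary_space K\<^esub>
      ordinary_class K (with_jumping_chord X r 0 qm) =
    ordinary_class K (with_jumping_chord X r 0 pp) \<oplus>\<^bsub>ordinary_space K\<^esub>
      ordinary_class K (with_jumping_chord X r 0 qp)"
proof -
  have D: "with_jumping_chord X r 0 x \<in> black_chord_diagrams" if "x \<in> {pm, pp, qm, qp}" for x
    unfolding with_jumping_chord_def
    using diagram_in_black_iff[OF four_term_data_chord_collection[OF d that]] X
    by (simp add: all_oriented_def)
  let ?F = "free_module K black_chord_diagrams"
  let ?e = "\<lambda>x. basis_vector K (with_jumping_chord X r 0 x)"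
  have "(?e pm \<ominus>\<^bsub>?F\<^esub> ?e pp) \<ominus>\<^bsub>?F\<^esub> (?e qp \<ominus>\<^bsub>?F\<^esub> ?e qm) \<in> ordinary_4T_relations K"
    unfolding ordinary_4T_relations_def Let_def using X d by blast
  thus ?thesis
    unfolding ordinary_space_def ordinary_class_def ordinary_4T_span_def
    by (intro generated_quotient_four_term[OF K D D D D ordinary_4T_relations_closed[OF K]]) simp_all
qed

section \<open>The projection to black diagrams\<close>

lemma black_projection_linear:
  assumes K: "cring K"
  shows "black_projection K \<in> linear_maps K (framed_space K) (ordinary_space K)"
proof -
  let ?A = "ordinary_space K"
  define g where "g d = (if d \<in> black_chord_diagrams then ordinary_class K d else \<zero>\<^bsub>?A\<^esub>)" for d
  have A: "module K ?A" by (rule module_ordinary_space[OF K])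
  interpret A: module K ?A by fact
  have g: "g \<in> framed_chord_diagrams \<rightarrow> carrier ?A"
    by (auto simp: g_def ordinary_class_closed[OF K])
  \<comment> \<open>Blackness depends on \<open>\<phi>\<close> and \<open>X\<close> but not on the
    position \<open>x\<close>, so the four terms of a relation with oriented \<open>v\<close> are
    black together or not at all.\<close>
  have gD: "g (with_jumping_chord X r \<phi> x) =
      (if \<phi> = 0 \<and> all_oriented X then ordinary_class K (with_jumping_chord X r 0 x) else \<zero>\<^bsub>?A\<^esub>)"
    and D: "with_jumping_chord X r \<phi> x \<in> framed_chord_diagrams"
    if "four_term_data X \<psi> p q r pm pp qm qp" "x \<in> {pm, pp, qm, qp}" for X \<psi> p q r pm pp qm qp x \<phi>
  proof -
    note c = four_term_data_chord_collection[OF that]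
    show "with_jumping_chord X r \<phi> x \<in> framed_chord_diagrams"
      unfolding with_jumping_chord_def by (rule diagram_in_framed[OF c])
    show "g (with_jumping_chord X r \<phi> x) =
        (if \<phi> = 0 \<and> all_oriented X then ordinary_class K (with_jumping_chord X r 0 x) else \<zero>\<^bsub>?A\<^esub>)"
      unfolding g_def with_jumping_chord_def diagram_in_black_iff[OF c] by (auto simp: all_oriented_def)
  qed
  have kill: "linear_extension K ?A g \<rho> = \<zero>\<^bsub>?A\<^esub>" if "\<rho> \<in> framed_4T_relations K" for \<rho>
    using that unfolding framed_4T_relations_alt
  proof (elim UnE CollectE exE conjE)
    fix X p q r pm pp qm qp \<phi>
    assume \<rho>: "\<rho> = four_terms K X r \<phi> \<phi> pm pp qp qm" and d: "four_term_data X 0 p q r pm pp qm qp"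
    show ?thesis unfolding \<rho> four_terms_def Let_def
      by (subst linear_extension_four_term[OF A g])
         (use ordinary_class_four_term[OF K _ d] in \<open>simp_all add: D[OF d] gD[OF d]\<close>)
  next
    fix X p q r pm pp qm qp \<phi>
    assume \<rho>: "\<rho> = four_terms K X r \<phi> (\<phi> + 1) pm pp qm qp"
      and d: "four_term_data X 1 p q r pm pp qm qp"
    \<comment> \<open>The chord \<open>v\<close> belongs to \<open>X\<close>, so no term is black,
      although one of \<open>\<phi>\<close> and \<open>\<phi> + 1\<close> is 0.\<close>
    have "\<not> all_oriented X" using d by (force simp: four_term_data_def all_oriented_def)
    thus ?thesis unfolding \<rho> four_terms_def Let_def
      by (subst linear_extension_four_term[OF A g]) (simp_all add: D[OF d] gD[OF d])
  qed
  show ?thesis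
    unfolding black_projection_def framed_space_def framed_4T_span_def g_def[abs_def, symmetric]
    by (rule induced_generated_linear[OF free_module_is_module[OF K] A
          linear_extension_linear[OF A g] framed_4T_relations_closed[OF K] kill])
qed

section \<open>The comultiplication\<close>

text \<open>The innermost function of \<open>comult\<close>, living on representatives; it is
  isolated because it must be shown constant on orbits before \<open>induced\<close> can be
  evaluated.\<close>

definition splitting_sum ::
    "('k, 'r) ring_scheme \<Rightarrow> framed_chord set
      \<Rightarrow> ((framed_chord_diagram \<Rightarrow> 'k) set \<times> (framed_chord_diagram \<Rightarrow> 'k) set \<Rightarrow> 'k) set" where
  "splitting_sum K X =
     (\<Oplus>\<^bsub>tensor_product K (framed_space K) (framed_space K)\<^esub>I\<in>Pow X.
        pure_tensor K (framed_space K) (framed_space K)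
          (framed_class K (diagram I)) (framed_class K (diagram (X - I))))"

context
  fixes K :: "('k, 'r) ring_scheme" and M T cl t
  assumes K: "cring K"
  defines "M \<equiv> framed_space K"
  defines "T \<equiv> tensor_product K M M"
  defines "cl \<equiv> \<lambda>X. framed_class K (diagram X)"
  defines "t \<equiv> pure_tensor K M M"
begin

interpretation M: module K M unfolding M_def by (rule module_framed_space[OF K])

interpretation T: module K T unfolding T_def by (rule module_tensor_product) unfold_locales

lemma framed_class_diagram_closed: "chord_collection X \<Longrightarrow> cl X \<in> carrier M"
  unfolding cl_def M_def by (intro framed_class_closed[OF K] diagram_in_framed)

lemma framed_tensor_closed: "x \<in> carrier M \<Longrightarrow> y \<in> carrier M \<Longrightarrow> t x y \<in> carrier T"
  unfolding t_def T_def by (rule pure_tensor_closed[OF M.module_axioms M.module_axioms])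

lemma framed_tensor_add_left: "x \<in> carrier M \<Longrightarrow> x' \<in> carrier M \<Longrightarrow> y \<in> carrier M \<Longrightarrow>
    t (x \<oplus>\<^bsub>M\<^esub> x') y = t x y \<oplus>\<^bsub>T\<^esub> t x' y"
  unfolding t_def T_def by (rule pure_tensor_add_left[OF M.module_axioms M.module_axioms])

lemma framed_tensor_add_right: "x \<in> carrier M \<Longrightarrow> y \<in> carrier M \<Longrightarrow> y' \<in> carrier M \<Longrightarrow>
    t x (y \<oplus>\<^bsub>M\<^esub> y') = t x y \<oplus>\<^bsub>T\<^esub> t x y'"
  unfolding t_def T_def by (rule pure_tensor_add_right[OF M.module_axioms M.module_axioms])

lemma splitting_sum_eq: "splitting_sum K X = (\<Oplus>\<^bsub>T\<^esub>I\<in>Pow X. t (cl I) (cl (X - I)))"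
  unfolding splitting_sum_def M_def T_def cl_def t_def ..

lemma framed_tensor_class_closed:
  assumes "chord_collection X" "I \<subseteq> X" "J \<subseteq> X"
  shows "t (cl I) (cl J) \<in> carrier T"
  by (intro framed_tensor_closed framed_class_diagram_closed chord_collection_subset[OF assms(1)] assms(2,3))

lemma splitting_sum_closed: "chord_collection X \<Longrightarrow> splitting_sum K X \<in> carrier T"
  unfolding splitting_sum_eq by (intro T.finsum_closed Pi_I framed_tensor_class_closed[of X]) auto

text \<open>A diffeomorphism carries splittings of \<open>X\<close> bijectively to splittings of its
  image, complements to complements, and leaves the diagram of each part unchanged.\<close>

lemma splitting_sum_chord_image:
  assumes X: "chord_collection X" and h: "oriented_circle_diffeo h"
  shows "splitting_sum K (map_prod (image h) id ` X) = splitting_sum K X"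
proof -
  let ?h = "map_prod (image h) id"
  note ep = endpoints_in_circle[OF X]
  have inj: "inj_on ?h X" by (rule chord_image_inj[OF h ep])
  have cl: "cl (?h ` I) = cl I" if "I \<subseteq> X" for I
    unfolding cl_def using diagram_chord_image[OF h] endpoints_mono[OF that] ep by simp
  have diff: "?h ` X - ?h ` I = ?h ` (X - I)" if "I \<subseteq> X" for I
    using inj_on_image_set_diff[OF inj, of X I] that by auto
  have eq: "t (cl (?h ` I)) (cl (?h ` X - ?h ` I)) = t (cl I) (cl (X - I))" if "I \<in> Pow X" for I
    using that by (simp add: diff cl)
  have closed: "t (cl I) (cl (X - I)) \<in> carrier T" if "I \<in> Pow X" for I
    using that by (intro framed_tensor_class_closed[OF X]) auto
  have "splitting_sum K (?h ` X) = (\<Oplus>\<^bsub>T\<^esub>J\<in>image ?h ` Pow X. t (cl J) (cl (?h ` X - J)))"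
    unfolding splitting_sum_eq by (simp add: image_Pow_surj[OF refl])
  also have "\<dots> = (\<Oplus>\<^bsub>T\<^esub>I\<in>Pow X. t (cl (?h ` I)) (cl (?h ` X - ?h ` I)))"
    by (rule T.finsum_reindex) (use inj_on_image_Pow[OF inj] eq closed in auto)
  also have "\<dots> = splitting_sum K X"
    unfolding splitting_sum_eq by (rule T.finsum_cong') (use eq closed in auto)
  finally show ?thesis .
qed

lemma induced_splitting_sum:
  assumes X: "chord_collection X"
  shows "induced (splitting_sum K) (diagram X) = splitting_sum K X"
proof -
  have "splitting_sum K ` diagram X = {splitting_sum K X}"
    using splitting_sum_chord_image[OF X] diagram_self[of X] by (auto simp: diagram_def)
  thus ?thesis by (simp add: induced_def)
qed

text \<open>The splittings are sorted by the part that receives \<open>u\<close>. The index set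
  becomes \<open>Pow X\<close>, which no longer depends on \<open>u\<close> and so is shared by all
  four terms of a relation.\<close>

lemma splitting_sum_insert:
  assumes X: "chord_collection (insert u X)" and u: "u \<notin> X"
  shows "splitting_sum K (insert u X) =
    (\<Oplus>\<^bsub>T\<^esub>I\<in>Pow X. t (cl I) (cl (insert u (X - I))) \<oplus>\<^bsub>T\<^esub> t (cl (insert u I)) (cl (X - I)))"
proof -
  let ?f = "\<lambda>I. t (cl I) (cl (insert u X - I))"
  have fin: "finite X" using chord_collectionD(1)[OF X] by simp
  have closed: "?f I \<in> carrier T" if "I \<subseteq> insert u X" for I
    by (intro framed_tensor_class_closed[OF X] that Diff_subset)
  have inj: "inj_on (insert u) (Pow X)" using u by (auto simp: inj_on_def)
  have f1: "?f I = t (cl I) (cl (insert u (X - I)))" if "I \<in> Pow X" for I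
    using that u by (auto intro!: arg_cong[of _ _ "\<lambda>J. t (cl I) (cl J)"])
  have f2: "?f (insert u I) = t (cl (insert u I)) (cl (X - I))" for I
    using u by (auto intro!: arg_cong[of _ _ "\<lambda>J. t (cl (insert u I)) (cl J)"])
  have closed2: "t (cl (insert u I)) (cl (X - I)) \<in> carrier T" if "I \<subseteq> X" for I
    using closed[of "insert u I"] that unfolding f2 by blast
  have "splitting_sum K (insert u X) = (\<Oplus>\<^bsub>T\<^esub>I\<in>Pow X. ?f I) \<oplus>\<^bsub>T\<^esub> (\<Oplus>\<^bsub>T\<^esub>I\<in>insert u ` Pow X. ?f I)"
    unfolding splitting_sum_eq Pow_insert
    by (rule T.finsum_Un_disjoint) (use fin u closed closed2 in auto)
  also have "(\<Oplus>\<^bsub>T\<^esub>I\<in>insert u ` Pow X. ?f I) = (\<Oplus>\<^bsub>T\<^esub>I\<in>Pow X. ?f (insert u I))"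
    by (rule T.finsum_reindex[OF _ inj], rule Pi_I, rule closed) blast
  also have "(\<Oplus>\<^bsub>T\<^esub>I\<in>Pow X. ?f I) \<oplus>\<^bsub>T\<^esub> (\<Oplus>\<^bsub>T\<^esub>I\<in>Pow X. ?f (insert u I)) =
      (\<Oplus>\<^bsub>T\<^esub>I\<in>Pow X. ?f I \<oplus>\<^bsub>T\<^esub> ?f (insert u I))"
  proof (rule T.finsum_addf[symmetric]; rule Pi_I)
    fix I assume "I \<in> Pow X"
    thus "?f I \<in> carrier T" "?f (insert u I) \<in> carrier T"
      by (intro closed; blast)+
  qed
  also have "\<dots> = (\<Oplus>\<^bsub>T\<^esub>I\<in>Pow X. t (cl I) (cl (insert u (X - I))) \<oplus>\<^bsub>T\<^esub> t (cl (insert u I)) (cl (X - I)))"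
  proof (rule T.finsum_cong')
    show "(\<lambda>I. t (cl I) (cl (insert u (X - I))) \<oplus>\<^bsub>T\<^esub> t (cl (insert u I)) (cl (X - I))) \<in> Pow X \<rightarrow> carrier T"
      by (intro Pi_I T.add.m_closed framed_tensor_class_closed[OF X]) auto
  qed (simp_all only: f1 f2)
  finally show ?thesis .
qed

text \<open>With the common index set, the identity can be proved for each \<open>I\<close>
  separately. There it splits into two four-term identities, one for \<open>I\<close> and one for
  \<open>X - I\<close>, each tensored with the class of the other part.\<close>

lemma splitting_sum_four_term:
  assumes X: "chord_collection X" and r: "r \<notin> endpoints X"
    and c: "\<And>x \<theta>. x \<in> {a, b, c, d} \<Longrightarrow> chord_collection (insert ({r, x}, \<theta>) X)"
    and rel: "\<And>S. S \<subseteq> X \<Longrightarrow> four_terms K S r \<phi> \<phi>' a b c d \<in> framed_4T_relations K \<or>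
      with_jumping_chord S r \<phi> a = with_jumping_chord S r \<phi> b \<and>
      with_jumping_chord S r \<phi>' c = with_jumping_chord S r \<phi>' d"
  shows "splitting_sum K (insert ({r, a}, \<phi>) X) \<oplus>\<^bsub>T\<^esub> splitting_sum K (insert ({r, d}, \<phi>') X) =
    splitting_sum K (insert ({r, b}, \<phi>) X) \<oplus>\<^bsub>T\<^esub> splitting_sum K (insert ({r, c}, \<phi>') X)"
proof -
  define D where "D \<theta> x S = cl (insert ({r, x}, \<theta>) S)" for \<theta> x S
  have Dc: "D \<theta> x S \<in> carrier M" if "x \<in> {a, b, c, d}" "S \<subseteq> X" for \<theta> x S
    unfolding D_def by (rule framed_class_diagram_closed[OF chord_collection_subset[OF c[OF that(1)]]]) (use that in auto)
  have Sc: "cl S \<in> carrier M" if "S \<subseteq> X" for S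
    by (rule framed_class_diagram_closed[OF chord_collection_subset[OF X that]])
  \<comment> \<open>Either a relation of the part gives this directly, or the terms for
    \<open>a\<close> and \<open>b\<close> agree and so do those for \<open>c\<close> and
    \<open>d\<close>.\<close>
  have four: "D \<phi> a S \<oplus>\<^bsub>M\<^esub> D \<phi>' d S = D \<phi> b S \<oplus>\<^bsub>M\<^esub> D \<phi>' c S" if S: "S \<subseteq> X" for S
  proof -
    have cS: "chord_collection (insert ({r, x}, \<theta>) S)" if "x \<in> {a, b, c, d}" for x \<theta>
      by (rule chord_collection_subset[OF c[OF that]]) (use S in auto)
    show ?thesis
      using rel[OF S] framed_class_four_term[where X = S and r = r and a = a and b = b and c = c and d = d, OF K _ cS]
      by (auto simp: D_def cl_def M_def with_jumping_chord_def)
  qed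
  define s where "s \<theta> x I = t (cl I) (D \<theta> x (X - I)) \<oplus>\<^bsub>T\<^esub> t (D \<theta> x I) (cl (X - I))" for \<theta> x I
  have sc: "s \<theta> x I \<in> carrier T" if "x \<in> {a, b, c, d}" "I \<subseteq> X" for \<theta> x I
    unfolding s_def using that by (intro T.add.m_closed framed_tensor_closed Dc Sc) auto
  have ss: "splitting_sum K (insert ({r, x}, \<theta>) X) = (\<Oplus>\<^bsub>T\<^esub>I\<in>Pow X. s \<theta> x I)"
    if "x \<in> {a, b, c, d}" for x \<theta>
  proof -
    have "({r, x}, \<theta>) \<notin> X" using r by (force simp: endpoints_def)
    from splitting_sum_insert[OF c[OF that] this] show ?thesis by (simp add: s_def D_def)
  qed
  \<comment> \<open>Bilinearity groups the four tensors by the factor without the jumping chord,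
    leaving in each bracket one side of \<open>four\<close>.\<close>
  have collect: "s \<phi> x I \<oplus>\<^bsub>T\<^esub> s \<phi>' y I =
      t (cl I) (D \<phi> x (X - I) \<oplus>\<^bsub>M\<^esub> D \<phi>' y (X - I)) \<oplus>\<^bsub>T\<^esub> t (D \<phi> x I \<oplus>\<^bsub>M\<^esub> D \<phi>' y I) (cl (X - I))"
    if "x \<in> {a, b, c, d}" "y \<in> {a, b, c, d}" "I \<subseteq> X" for x y I
  proof -
    have m: "cl I \<in> carrier M" "cl (X - I) \<in> carrier M" "D \<theta> x I \<in> carrier M" "D \<theta> y I \<in> carrier M"
      "D \<theta> x (X - I) \<in> carrier M" "D \<theta> y (X - I) \<in> carrier M" for \<theta>
      using that by (auto intro!: Sc Dc simp del: insert_iff)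
    show ?thesis
      unfolding s_def by (simp add: m framed_tensor_add_left framed_tensor_add_right framed_tensor_closed T.add.m_ac)
  qed
  have eq: "s \<phi> a I \<oplus>\<^bsub>T\<^esub> s \<phi>' d I = s \<phi> b I \<oplus>\<^bsub>T\<^esub> s \<phi>' c I" if "I \<subseteq> X" for I
    using that by (simp add: collect four)
  have sum: "splitting_sum K (insert ({r, x}, \<phi>) X) \<oplus>\<^bsub>T\<^esub> splitting_sum K (insert ({r, y}, \<phi>') X) =
      (\<Oplus>\<^bsub>T\<^esub>I\<in>Pow X. s \<phi> x I \<oplus>\<^bsub>T\<^esub> s \<phi>' y I)" if "x \<in> {a, b, c, d}" "y \<in> {a, b, c, d}" for x y
    unfolding ss[OF that(1)] ss[OF that(2)]
    by (rule T.finsum_addf[symmetric]) (use sc that in \<open>auto simp del: insert_iff\<close>)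
  have "(\<Oplus>\<^bsub>T\<^esub>I\<in>Pow X. s \<phi> a I \<oplus>\<^bsub>T\<^esub> s \<phi>' d I) = (\<Oplus>\<^bsub>T\<^esub>I\<in>Pow X. s \<phi> b I \<oplus>\<^bsub>T\<^esub> s \<phi>' c I)"
    by (rule T.finsum_cong') (use sc eq in auto)
  thus ?thesis by (simp add: sum[of a d] sum[of b c])
qed

lemma comult_linear: "comult K \<in> linear_maps K M T"
proof -
  define g where "g = induced (splitting_sum K)"
  have g: "g \<in> framed_chord_diagrams \<rightarrow> carrier T"
    by (auto simp: g_def framed_chord_diagrams_def induced_splitting_sum splitting_sum_closed)
  have kill: "linear_extension K T g \<rho> = \<zero>\<^bsub>T\<^esub>" if \<rho>: "\<rho> \<in> framed_4T_relations K" for \<rho>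
    using \<rho>
  proof (rule framed_4T_relationE)
    fix X r \<phi> \<phi>' a b c d
    assume \<rho>: "\<rho> = four_terms K X r \<phi> \<phi>' a b c d"
      and X: "chord_collection X" "r \<notin> endpoints X"
      and c: "\<And>x \<theta>. x \<in> {a, b, c, d} \<Longrightarrow> chord_collection (insert ({r, x}, \<theta>) X)"
      and rel: "\<And>S. S \<subseteq> X \<Longrightarrow> four_terms K S r \<phi> \<phi>' a b c d \<in> framed_4T_relations K \<or>
        with_jumping_chord S r \<phi> a = with_jumping_chord S r \<phi> b \<and>
        with_jumping_chord S r \<phi>' c = with_jumping_chord S r \<phi>' d"
    have D: "with_jumping_chord X r \<theta> x \<in> framed_chord_diagrams"
      and gD: "g (with_jumping_chord X r \<theta> x) = splitting_sum K (insert ({r, x}, \<theta>) X)"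
      if "x \<in> {a, b, c, d}" for x \<theta>
      using diagram_in_framed[OF c[OF that]] induced_splitting_sum[OF c[OF that]]
      by (simp_all add: with_jumping_chord_def g_def)
    show ?thesis unfolding \<rho> four_terms_def Let_def
      by (subst linear_extension_four_term[OF T.module_axioms g])
         (use splitting_sum_four_term[OF X c rel] in \<open>simp_all add: D gD\<close>)
  qed
  have "comult K = induced (linear_extension K T g)"
    unfolding comult_def Let_def g_def splitting_sum_def[abs_def] M_def T_def ..
  moreover have "induced (linear_extension K T g) \<in> linear_maps K M T"
    unfolding M_def framed_space_def framed_4T_span_def
    by (rule induced_generated_linear[OF free_module_is_module[OF K] T.module_axioms
          linear_extension_linear[OF T.module_axioms g] framed_4T_relations_closed[OF K] kill])
  ultimately show ?thesis by simp
qed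

end

section \<open>Composing the coaction with a pair of weight systems\<close>

theorem theorem3p4:
  fixes K :: "('k, 'r) ring_scheme"
    and A :: "('k, 'a, 's) module_scheme"
    and A' :: "('k, 'b, 't) module_scheme"
    and w :: "(framed_chord_diagram \<Rightarrow> 'k) set \<Rightarrow> 'a"
    and w' :: "(framed_chord_diagram \<Rightarrow> 'k) set \<Rightarrow> 'b"
  assumes "field K" and "characteristic_zero K"
    and "module K A" and "module K A'"
    and "weight_system K A w"
    and "framed_weight_system K A' w'"
  shows "framed_weight_system K (tensor_product K A A') (tensor_map K A A' w w' \<circ> coaction K)"
proof -
  have K: "cring K" using \<open>module K A\<close> by (rule module.axioms)
  note M = module_framed_space[OF K] and O = module_ordinary_space[OF K]
  have "w \<in> linear_maps K (ordinary_space K) A" "w' \<in> linear_maps K (framed_space K) A'"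
    using assms by (auto simp: weight_system_def framed_weight_system_def)
  hence "tensor_map K A A' w w' \<in> linear_maps K
      (tensor_product K (ordinary_space K) (framed_space K)) (tensor_product K A A')"
    by (rule tensor_map_linear[OF O M assms(3,4)])
  moreover have "coaction K \<in> linear_maps K (framed_space K)
      (tensor_product K (ordinary_space K) (framed_space K))"
    unfolding coaction_def
    by (rule linear_maps_comp[OF comult_linear[OF K]
          tensor_map_linear[OF M M O M black_projection_linear[OF K] linear_maps_id]])
  ultimately show ?thesis
    unfolding framed_weight_system_def
    using linear_maps_comp module_tensor_product[OF assms(3,4)] by blast
qed

end
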